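(* Let $\{(x_k,y_k,\lambda_k)\}_{k\ge 0}$ be generated by the proximal ADMM (described in the context) with stepsize $\theta\in(0,2)$, and assume that the initial pair $(y_0,\lambda_0)\in\mathbb{R}^p\times\mathbb{R}^l$ is such that the quantity $\eta_0:=\eta_0(y_0,\lambda_0;\theta)$ is finite. Define $\Delta_\beta^0:=\mathcal{L}_\beta(x_0,y_0,\lambda_0)-\bar{\mathcal{L}}$ and, for every $k\ge 1$, $$\hat\lambda_k:=\lambda_{k-1}-\beta\,(Ax_k+By_{k-1}-b).$$ Then, for every $k\ge 1$, $$-G\,\Delta x_k\in\partial f(x_k)-A^*\hat\lambda_k,$$ and there exists $j$ with $1\le j\le k$ such that $$\|\Delta x_j\|_G\le\sqrt{\frac{6\max\{\eta_0,\Delta_\beta^0\}}{k}},\qquad \|\nabla g(y_j)-B^*\hat\lambda_j\|\le(\beta\|B^*B\|+\tau)\sqrt{\frac{3\max\{\eta_0,\Delta_\beta^0\}}{\delta_1 k}},$$ $$\|Ax_j+By_j-b\|\le\frac{1}{\beta\theta}\sqrt{\frac{3\max\{\eta_0,\Delta_\beta^0\}}{\delta_2 k}},$$ where $$\delta_2:=\left(\beta\theta+\frac{6\theta\gamma(L^2+\tau^2)}{\sigma_B^+\delta_1}\right)^{-1}.$$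
   Context: **Notation.** $\langle\cdot,\cdot\rangle$ and $\|\cdot\|$ are the Euclidean inner product and norm (for matrices, $\|\cdot\|$ is the induced operator norm). $B^*$ is the transpose of $B$, $\mathrm{Im}(Q)$ is the image of a matrix $Q$, and $\mathcal{P}_{Q}$ is the orthogonal projection onto $\mathrm{Im}(Q)$. For $G$ symmetric positive semidefinite, $\|x\|_G:=\langle Gx,x\rangle^{1/2}$. For a sequence $\{z_k\}_{k\ge0}$, $\Delta z_k:=z_k-z_{k-1}$ for $k\ge1$. A function $h:\mathbb{R}^n\to(-\infty,\infty]$ is proper if it is finite at some point. **Subdifferential.** Let $h:\mathbb{R}^n\to(-\infty,\infty]$ be proper lower semicontinuous with domain $\mathrm{dom}\,h=\{x: h(x)<\infty\}$. The Fréchet subdifferential $\hat\partial h(x)$ at $x\in\mathrm{dom}\,h$ is the set of $u$ with $\liminf_{y\to x,\,y\ne x}\frac{h(y)-h(x)-\langle u,y-x\rangle}{\|y-x\|}\ge0$, and $\hat\partial h(x)=\emptyset$ for $x\notin\mathrm{dom}\,h$. The (limiting) subdifferential $\partial h(x)$ at $x\in\mathrm{dom}\,h$ is the set of $u$ for which there are $x_i\to x$ with $h(x_i)\to h(x)$ and $u_i\in\hat\partial h(x_i)$ with $u_i\to u$. **Problem and assumptions.** Let $A\in\mathbb{R}^{l\times n}$, $B\in\mathbb{R}^{l\times p}$, $b\in\mathbb{R}^l$; the problem is $\min\{f(x)+g(y): Ax+By=b\}$. Assume: (A0) $f:\mathbb{R}^n\to(-\infty,\infty]$ is proper lower semicontinuous.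 (A1) $B\ne0$ and $\mathrm{Im}(B)\supset\{b\}\cup\mathrm{Im}(A)$. (A2) $g:\mathbb{R}^p\to\mathbb{R}$ is differentiable and there is $L>0$ with $\|\mathcal{P}_{B^*}(\nabla g(y'))-\mathcal{P}_{B^*}(\nabla g(y))\|\le L\|y'-y\|$ for all $y,y'$. (A3) There is $m\ge0$ such that $g(\cdot)+\frac m2\|\cdot\|^2$ is convex. (A4) There is $\bar\beta\ge0$ such that $\bar{\mathcal{L}}:=\inf_{(x,y)}\{f(x)+g(y)+\frac{\bar\beta}{2}\|Ax+By-b\|^2\}>-\infty$. The augmented Lagrangian is $\mathcal{L}_\beta(x,y,\lambda):=f(x)+g(y)-\langle\lambda,Ax+By-b\rangle+\frac\beta2\|Ax+By-b\|^2$. **Parameters.** $\sigma_B$ (resp. $\sigma_B^+$) is the smallest eigenvalue (resp. smallest positive eigenvalue) of $B^*B$. $G\in\mathbb{R}^{n\times n}$ is symmetric positive semidefinite, $\theta\in(0,2)$, $\gamma:=\frac{\theta}{(1-|\theta-1|)^2}$, and $\beta>0$, $\beta\ge\bar\beta$, $\tau\ge0$ are chosen such that $$\delta_1:=\frac{\beta\sigma_B+\tau-m}{4}-\frac{3\gamma(L^2+\tau^2)}{\beta\sigma_B^+}>0.$$ **Proximal ADMM.** From an initial point $(x_0,y_0,\lambda_0)\in\mathbb{R}^n\times\mathbb{R}^p\times\mathbb{R}^l$, for $k\ge1$: $x_k$ is an optimal solution (assumed to exist) of $\min_x\{\mathcal{L}_\beta(x,y_{k-1},\lambda_{k-1})+\frac12\|x-x_{k-1}\|_G^2\}$;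 $y_k$ is the optimal solution of $\min_y\{\mathcal{L}_\beta(x_k,y,\lambda_{k-1})+\frac\tau2\|y-y_{k-1}\|^2\}$; and $\lambda_k=\lambda_{k-1}-\theta\beta(Ax_k+By_k-b)$. **The quantity $\eta_0$.** Put $c_1:=\frac{2|\theta-1|}{\beta\theta(1-|\theta-1|)\sigma_B^+}\ge0$. Then $\eta_0(y_0,\lambda_0;\theta)$ is the minimum of $\frac{c_1}{2}\|B^*\Delta\lambda_0\|^2+\frac{\beta\sigma_B+\tau-m}{4}\|\Delta y_0\|^2$ over all $(\Delta y_0,\Delta\lambda_0)\in\mathbb{R}^p\times\mathbb{R}^l$ satisfying $\tau\Delta y_0+(1-1/\theta)B^*\Delta\lambda_0=B^*\lambda_0-\nabla g(y_0)$ (and $+\infty$ if there is no such pair). If $f(x_0)=+\infty$, then $\Delta_\beta^0=+\infty$ and the usual extended-real conventions apply. *)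

theory Defs
  imports "HOL-Analysis.Analysis"
begin

section \<open>Functions with values in the half-extended real line\<close>

definition proper :: "('a \<Rightarrow> ereal) \<Rightarrow> bool" where
  "proper h \<longleftrightarrow> (\<forall>x. h x \<noteq> -\<infinity>) \<and> (\<exists>x. h x \<noteq> \<infinity>)"

definition lsc :: "('a::topological_space \<Rightarrow> ereal) \<Rightarrow> bool" where
  "lsc h \<longleftrightarrow> (\<forall>x. h x \<le> Liminf (at x) h)"

definition frechet_subdiff :: "('a::real_inner \<Rightarrow> ereal) \<Rightarrow> 'a \<Rightarrow> 'a set" where
  "frechet_subdiff h x =
     (if h x < \<infinity>
      then {u. Liminf (at x) (\<lambda>y. (h y - h x - ereal (u \<bullet> (y - x))) / ereal (norm (y - x))) \<ge> 0}
      else {})"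

definition lim_subdiff :: "('a::real_inner \<Rightarrow> ereal) \<Rightarrow> 'a \<Rightarrow> 'a set" where
  "lim_subdiff h x =
     (if h x < \<infinity>
      then {u. \<exists>xi ui. xi \<longlonglongrightarrow> x \<and> (\<lambda>i. h (xi i)) \<longlonglongrightarrow> h x \<and>
                 (\<forall>i. ui i \<in> frechet_subdiff h (xi i)) \<and> ui \<longlonglongrightarrow> u}
      else {})"

text \<open>Square root on \<open>[0,\<infinity>]\<close>; the values at negative arguments are irrelevant.\<close>

definition esqrt :: "ereal \<Rightarrow> ereal" where
  "esqrt z = (if z = \<infinity> then \<infinity> else ereal (sqrt (real_of_ereal z)))"


section \<open>Linear algebra and gradients\<close>

definition pos_semidef :: "real^'n^'n \<Rightarrow> bool" where
  "pos_semidef G \<longleftrightarrow> transpose G = G \<and> (\<forall>x. 0 \<le> (G *v x) \<bullet> x)"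

definition seminorm_of :: "real^'n^'n \<Rightarrow> real^'n \<Rightarrow> real" where
  "seminorm_of G x = sqrt ((G *v x) \<bullet> x)"

definition is_eigenvalue :: "real^'n^'n \<Rightarrow> real \<Rightarrow> bool" where
  "is_eigenvalue M \<mu> \<longleftrightarrow> (\<exists>v. v \<noteq> 0 \<and> M *v v = \<mu> *\<^sub>R v)"

definition sigma_min :: "real^'p^'l \<Rightarrow> real" where
  "sigma_min B = (LEAST \<mu>. is_eigenvalue (transpose B ** B) \<mu>)"

definition sigma_pos :: "real^'p^'l \<Rightarrow> real" where
  "sigma_pos B = (LEAST \<mu>. is_eigenvalue (transpose B ** B) \<mu> \<and> \<mu> > 0)"

definition matrix_norm :: "real^'n^'m \<Rightarrow> real" where
  "matrix_norm M = onorm (\<lambda>v. M *v v)"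

definition image_proj :: "real^'n^'m \<Rightarrow> real^'m \<Rightarrow> real^'m" where
  "image_proj Q v =
     (THE w. w \<in> range (\<lambda>z. Q *v z) \<and> (\<forall>s\<in>range (\<lambda>z. Q *v z). (v - w) \<bullet> s = 0))"

definition grad :: "('a::real_inner \<Rightarrow> real) \<Rightarrow> 'a \<Rightarrow> 'a" where
  "grad g y = (THE D. GDERIV g y :> D)"


section \<open>Augmented Lagrangian and the proximal ADMM\<close>

definition aug_lagrangian ::
  "(real^'n \<Rightarrow> ereal) \<Rightarrow> (real^'p \<Rightarrow> real) \<Rightarrow> real^'n^'l \<Rightarrow> real^'p^'l \<Rightarrow> real^'l \<Rightarrow> real
     \<Rightarrow> real^'n \<Rightarrow> real^'p \<Rightarrow> real^'l \<Rightarrow> ereal" where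
  "aug_lagrangian f g A B b \<beta> x y lam =
     f x + ereal (g y - lam \<bullet> (A *v x + B *v y - b) + \<beta> / 2 * (norm (A *v x + B *v y - b))\<^sup>2)"

definition penalty_inf ::
  "(real^'n \<Rightarrow> ereal) \<Rightarrow> (real^'p \<Rightarrow> real) \<Rightarrow> real^'n^'l \<Rightarrow> real^'p^'l \<Rightarrow> real^'l \<Rightarrow> real \<Rightarrow> ereal" where
  "penalty_inf f g A B b \<beta>' =
     (INF (x, y) \<in> UNIV. f x + ereal (g y + \<beta>' / 2 * (norm (A *v x + B *v y - b))\<^sup>2))"

text \<open>The sequences are total on \<open>nat\<close>, with index 0 the arbitrary initial point.\<close>

definition proximal_admm ::
  "(real^'n \<Rightarrow> ereal) \<Rightarrow> (real^'p \<Rightarrow> real) \<Rightarrow> real^'n^'l \<Rightarrow> real^'p^'l \<Rightarrow> real^'l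
     \<Rightarrow> real^'n^'n \<Rightarrow> real \<Rightarrow> real \<Rightarrow> real
     \<Rightarrow> (nat \<Rightarrow> real^'n) \<Rightarrow> (nat \<Rightarrow> real^'p) \<Rightarrow> (nat \<Rightarrow> real^'l) \<Rightarrow> bool" where
  "proximal_admm f g A B b G \<theta> \<beta> \<tau> x y lam \<longleftrightarrow>
     (\<forall>k\<ge>1.
        is_arg_min (\<lambda>u. aug_lagrangian f g A B b \<beta> u (y (k-1)) (lam (k-1))
                         + ereal (1/2 * (seminorm_of G (u - x (k-1)))\<^sup>2)) (\<lambda>_. True) (x k) \<and>
        is_arg_min (\<lambda>v. aug_lagrangian f g A B b \<beta> (x k) v (lam (k-1))
                         + ereal (\<tau>/2 * (norm (v - y (k-1)))\<^sup>2)) (\<lambda>_. True) (y k) \<and>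
        lam k = lam (k-1) - (\<theta> * \<beta>) *\<^sub>R (A *v x k + B *v y k - b))"


section \<open>Constants of the complexity bound\<close>

definition gamma_const :: "real \<Rightarrow> real" where
  "gamma_const \<theta> = \<theta> / (1 - \<bar>\<theta> - 1\<bar>)\<^sup>2"

definition delta1 :: "real^'p^'l \<Rightarrow> real \<Rightarrow> real \<Rightarrow> real \<Rightarrow> real \<Rightarrow> real \<Rightarrow> real" where
  "delta1 B L m \<theta> \<beta> \<tau> =
     (\<beta> * sigma_min B + \<tau> - m) / 4 - 3 * gamma_const \<theta> * (L\<^sup>2 + \<tau>\<^sup>2) / (\<beta> * sigma_pos B)"

definition delta2 :: "real^'p^'l \<Rightarrow> real \<Rightarrow> real \<Rightarrow> real \<Rightarrow> real \<Rightarrow> real \<Rightarrow> real" where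
  "delta2 B L m \<theta> \<beta> \<tau> =
     inverse (\<beta> * \<theta> + 6 * \<theta> * gamma_const \<theta> * (L\<^sup>2 + \<tau>\<^sup>2) / (sigma_pos B * delta1 B L m \<theta> \<beta> \<tau>))"

definition c1_const :: "real^'p^'l \<Rightarrow> real \<Rightarrow> real \<Rightarrow> real" where
  "c1_const B \<theta> \<beta> = 2 * \<bar>\<theta> - 1\<bar> / (\<beta> * \<theta> * (1 - \<bar>\<theta> - 1\<bar>) * sigma_pos B)"

text \<open>The infimum over an infeasible constraint is \<open>\<infinity>\<close> in \<^typ>\<open>ereal\<close>. In the feasible case, for
  \<open>\<beta> \<sigma>\<^sub>B + \<tau> - m > 0\<close>, \<open>\<beta> > 0\<close>, \<open>0 < \<theta> < 2\<close> and \<open>B \<noteq> 0\<close>, it is attained: the objective is a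
  nonnegative quadratic on an affine subspace.\<close>

definition eta0 ::
  "(real^'p \<Rightarrow> real) \<Rightarrow> real^'p^'l \<Rightarrow> real \<Rightarrow> real \<Rightarrow> real \<Rightarrow> real \<Rightarrow> real^'p \<Rightarrow> real^'l \<Rightarrow> ereal" where
  "eta0 g B m \<theta> \<beta> \<tau> y0 lam0 =
     (INF (dy, dlam) \<in> {(dy, dlam).
          \<tau> *\<^sub>R dy + (1 - 1/\<theta>) *\<^sub>R (transpose B *v dlam) = transpose B *v lam0 - grad g y0}.
        ereal (c1_const B \<theta> \<beta> / 2 * (norm (transpose B *v dlam))\<^sup>2
               + (\<beta> * sigma_min B + \<tau> - m) / 4 * (norm dy)\<^sup>2))"

end

theory Submission
  imports Defs
begin

text \<open>
The inclusion for \<open>x k\<close> is the Fermat rule for the \<open>x\<close>-step: the part of the minimized function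
other than \<open>f\<close> is a quadratic, so minimality bounds \<open>f\<close> from below by a quadratic touching it at
\<open>x k\<close>, and its slope there is a Frechet, hence a limiting, subgradient
(\<open>x_step_subdiff\<close>).

The three bounds come from a Lyapunov function. Write \<open>dy\<close> and \<open>dlam\<close> for the increments of \<open>y\<close> and
\<open>lam\<close>, and \<open>curv = \<beta> \<sigma>\<^sub>B + \<tau> - m\<close>. The \<open>x\<close>-step and the strongly convex \<open>y\<close>-step decrease the
augmented Lagrangian, while the multiplier step increases it by \<open>\<parallel>dlam k\<parallel>\<^sup>2 / (\<theta> \<beta>)\<close>. That increase is
controlled by \<open>y\<close>: the optimality conditions of two successive \<open>y\<close>-steps say that \<open>B\<^sup>T dlam k\<close> is
\<open>1 - \<theta>\<close> times its predecessor plus \<open>\<theta>\<close> times a drift, of size \<open>L \<parallel>dy k\<parallel> + \<tau> \<parallel>dy k - dy (k-1)\<parallel>\<close>.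
Since \<open>\<bar>1 - \<theta>\<bar> < 1\<close>, this recursion is contracting up to the drift
(\<open>multiplier_increment_bound\<close>). Adding \<open>c\<^sub>1/2 \<parallel>B\<^sup>T dlam k\<parallel>\<^sup>2 + curv/4 \<parallel>dy k\<parallel>\<^sup>2\<close> to the Lagrangian
therefore gives a potential that drops at step \<open>k\<close> by at least
\<open>1/2 \<parallel>x k - x (k-1)\<parallel>\<^sub>G\<^sup>2 + \<delta>1 (\<parallel>dy k\<parallel>\<^sup>2 + \<parallel>dy (k-1)\<parallel>\<^sup>2)\<close> (\<open>pot_descent\<close>). The identity behind the
recursion holds at index 0 too when \<open>dy 0\<close>, \<open>dlam 0\<close> is any feasible pair in the definition of \<open>\<eta>0\<close>;
the potential then starts at the initial Lagrangian plus the objective value \<open>v\<close> of that pair.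

The potential stays above \<open>Lbar\<close>: it dominates \<open>Lbar - \<langle>lam k, A x k + B y k - b\<rangle>\<close>, which exceeds
\<open>Lbar\<close> by at least an increment of \<open>\<parallel>lam k\<parallel>\<^sup>2 / (2 \<theta> \<beta>)\<close>; if the nonincreasing potential fell below \<open>Lbar\<close>,
these increments would drive a nonnegative quantity to \<open>-\<infinity>\<close> (\<open>pot_bounded_below\<close>).

Telescoping gives at most \<open>v + \<Delta>0 \<le> 2 M\<close>, \<open>M = max v \<Delta>0\<close>, for the sum of the drops. Summing the bound on
\<open>dlam\<close> gives at most \<open>M\<close> for the sum of \<open>\<delta>2 \<parallel>dlam j\<parallel>\<^sup>2\<close>. This uses the term \<open>\<parallel>dy (k-1)\<parallel>\<^sup>2\<close>
in the drop: without it one would only get \<open>2 M\<close>. Hence the sum over \<open>j\<close> of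
\<open>1/2 \<parallel>x j - x (j-1)\<parallel>\<^sub>G\<^sup>2 + \<delta>1 \<parallel>dy j\<parallel>\<^sup>2 + \<delta>2 \<parallel>dlam j\<parallel>\<^sup>2\<close> is at most \<open>3 M\<close> (\<open>sum_progress_le\<close>), and some \<open>j\<close> is
no worse than the average. The iterates do not depend on the chosen pair, so the infimum over
feasible pairs replaces \<open>v\<close> by \<open>\<eta>0\<close>. The last two residuals of the theorem are bounded by multiples of
\<open>\<parallel>dy j\<parallel>\<close> and \<open>\<parallel>dlam j\<parallel>\<close>.
\<close>

section \<open>Extreme eigenvalues of the Gram matrix\<close>

\<comment> \<open>The default rule rewrites to \<open>v v* B\<close>, which hides the adjoint.\<close>
declare transpose_matrix_vector [simp del]

lemma inner_transpose_mult:
  fixes M :: "real^'n^'m"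
  shows "(transpose M *v u) \<bullet> v = u \<bullet> (M *v v)"
  by (simp add: dot_lmul_matrix transpose_matrix_vector)

lemma inner_mult_transpose:
  fixes M :: "real^'n^'m"
  shows "v \<bullet> (transpose M *v u) = (M *v v) \<bullet> u"
  by (metis inner_commute inner_transpose_mult)

lemma linear_coeff_zero_of_nonneg:
  fixes a c :: real
  assumes "\<And>t. 0 \<le> a * t + c * t\<^sup>2"
  shows "a = 0"
proof (rule ccontr)
  assume "a \<noteq> 0"
  define d where "d = \<bar>c\<bar> + 1"
  have d: "d > 0" "c < d" by (auto simp: d_def)
  \<comment> \<open>At \<open>t = - a / (2 d)\<close> with \<open>d > c\<close> the linear term dominates the quadratic one.\<close>
  have "a * (- a / (2 * d)) + c * (- a / (2 * d))\<^sup>2 = a\<^sup>2 / (4 * d\<^sup>2) * (c - 2 * d)"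
    using d by (simp add: field_simps power2_eq_square)
  also have "\<dots> < 0"
    using d \<open>a \<noteq> 0\<close> by (intro mult_pos_neg) auto
  finally show False using assms[of "- a / (2 * d)"] by linarith
qed

text \<open>A minimizer of \<open>\<parallel>B v\<parallel>\<^sup>2\<close> on the unit sphere of \<open>S\<close> is an eigenvector: stationarity in direction
  \<open>z = B\<^sup>T B w - \<mu> w\<close>, which lies in \<open>S\<close> by invariance, reads \<open>\<parallel>z\<parallel>\<^sup>2 = 0\<close>. The two instances used are the
  whole space (least eigenvalue) and the range of \<open>B\<^sup>T\<close> (least positive eigenvalue).\<close>

lemma gram_min_eigenpair_on_subspace:
  fixes B :: "real^'p^'l"
  assumes S: "subspace S" and ne: "v0 \<in> S" "v0 \<noteq> 0"
    and inv: "\<And>v. v \<in> S \<Longrightarrow> transpose B *v (B *v v) \<in> S"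
  obtains \<mu> w where "w \<in> S" "w \<noteq> 0" "transpose B *v (B *v w) = \<mu> *\<^sub>R w"
    "\<And>v. v \<in> S \<Longrightarrow> \<mu> * (norm v)\<^sup>2 \<le> (norm (B *v v))\<^sup>2"
proof -
  have cpt: "compact (sphere 0 1 \<inter> S)"
    by (intro compact_Int_closed closed_subspace S) simp
  have "(1 / norm v0) *\<^sub>R v0 \<in> sphere 0 1 \<inter> S"
    using ne S by (simp add: subspace_scale)
  then have nonempty: "sphere 0 1 \<inter> S \<noteq> {}" by blast
  have "continuous_on (sphere 0 1 \<inter> S) (\<lambda>v. (norm (B *v v))\<^sup>2)"
    by (intro continuous_intros)
  from continuous_attains_inf[OF cpt nonempty this]
  obtain w where w: "w \<in> S" "norm w = 1"
    and wmin: "\<And>v. v \<in> S \<Longrightarrow> norm v = 1 \<Longrightarrow> (norm (B *v w))\<^sup>2 \<le> (norm (B *v v))\<^sup>2"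
    by auto
  define \<mu> where "\<mu> = (norm (B *v w))\<^sup>2"
  have bound: "\<mu> * (norm v)\<^sup>2 \<le> (norm (B *v v))\<^sup>2" if "v \<in> S" for v
  proof (cases "v = 0")
    case False
    have "(norm (B *v w))\<^sup>2 \<le> (norm (B *v ((1 / norm v) *\<^sub>R v)))\<^sup>2"
      using that S False by (intro wmin) (auto simp: subspace_scale)
    also have "\<dots> = (norm (B *v v))\<^sup>2 / (norm v)\<^sup>2"
      by (simp add: matrix_vector_mult_scaleR power_mult_distrib power_divide)
    finally show ?thesis
      using False by (simp add: \<mu>_def field_simps)
  qed simp
  define z where "z = transpose B *v (B *v w) - \<mu> *\<^sub>R w"
  have z: "z \<in> S"
    using S w inv unfolding z_def by (intro subspace_diff subspace_scale) auto
  have "2 * ((B *v w) \<bullet> (B *v z) - \<mu> * (w \<bullet> z)) = 0"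
  proof (rule linear_coeff_zero_of_nonneg)
    fix t :: real
    have "\<mu> * (norm (w + t *\<^sub>R z))\<^sup>2 \<le> (norm (B *v (w + t *\<^sub>R z)))\<^sup>2"
      using S w z by (intro bound subspace_add subspace_scale)
    moreover have "(norm (w + t *\<^sub>R z))\<^sup>2 = 1 + 2 * t * (w \<bullet> z) + t\<^sup>2 * (norm z)\<^sup>2"
      using w(2) unfolding power2_norm_eq_inner norm_eq_1
      by (simp add: inner_add inner_commute algebra_simps power2_eq_square)
    moreover have "(norm (B *v (w + t *\<^sub>R z)))\<^sup>2
        = \<mu> + 2 * t * ((B *v w) \<bullet> (B *v z)) + t\<^sup>2 * (norm (B *v z))\<^sup>2"
      unfolding \<mu>_def power2_norm_eq_inner matrix_vector_right_distrib matrix_vector_mult_scaleR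
      by (simp add: inner_add inner_commute algebra_simps power2_eq_square)
    ultimately show "0 \<le> 2 * ((B *v w) \<bullet> (B *v z) - \<mu> * (w \<bullet> z)) * t
        + ((norm (B *v z))\<^sup>2 - \<mu> * (norm z)\<^sup>2) * t\<^sup>2"
      by (simp add: algebra_simps)
  qed
  moreover have "z \<bullet> z = (B *v w) \<bullet> (B *v z) - \<mu> * (w \<bullet> z)"
    by (subst (1) z_def) (simp add: inner_diff_left inner_transpose_mult)
  ultimately have "z \<bullet> z = 0" by simp
  then have "transpose B *v (B *v w) = \<mu> *\<^sub>R w"
    by (simp add: z_def)
  with w bound show thesis by (intro that) auto
qed

lemma gram_eigenvalue_rayleigh:
  assumes "is_eigenvalue (transpose B ** B) \<mu>"
  obtains v where "v \<noteq> 0" "transpose B *v (B *v v) = \<mu> *\<^sub>R v" "(norm (B *v v))\<^sup>2 = \<mu> * (norm v)\<^sup>2"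
proof -
  obtain v where v: "v \<noteq> 0" "transpose B *v (B *v v) = \<mu> *\<^sub>R v"
    using assms unfolding is_eigenvalue_def matrix_vector_mul_assoc[symmetric] by blast
  have "(norm (B *v v))\<^sup>2 = (transpose B *v (B *v v)) \<bullet> v"
    by (simp add: power2_norm_eq_inner inner_transpose_mult)
  also have "\<dots> = \<mu> * (norm v)\<^sup>2"
    by (simp add: v power2_norm_eq_inner)
  finally show thesis using v that by blast
qed

lemma sigma_min_bound:
  fixes B :: "real^'p^'l"
  shows "sigma_min B * (norm v)\<^sup>2 \<le> (norm (B *v v))\<^sup>2"
proof -
  obtain \<mu> w where w: "w \<noteq> 0" "transpose B *v (B *v w) = \<mu> *\<^sub>R w"
    and bound: "\<And>v. \<mu> * (norm v)\<^sup>2 \<le> (norm (B *v v))\<^sup>2"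
    by (rule gram_min_eigenpair_on_subspace[of UNIV "axis undefined 1" B]) (auto simp: axis_eq_0_iff)
  have "sigma_min B = \<mu>"
    unfolding sigma_min_def
  proof (rule Least_equality)
    show "is_eigenvalue (transpose B ** B) \<mu>"
      unfolding is_eigenvalue_def matrix_vector_mul_assoc[symmetric] using w by blast
  next
    fix \<nu> assume "is_eigenvalue (transpose B ** B) \<nu>"
    then obtain v where "v \<noteq> 0" "(norm (B *v v))\<^sup>2 = \<nu> * (norm v)\<^sup>2"
      by (rule gram_eigenvalue_rayleigh)
    with bound[of v] show "\<mu> \<le> \<nu>" by simp
  qed
  with bound show ?thesis by simp
qed

text \<open>The range of \<open>B\<^sup>T\<close> and the kernel of \<open>B\<close> are orthogonal complements.\<close>

lemma range_transpose_cases: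
  fixes B :: "real^'p^'l"
  obtains u w where "v = transpose B *v u + w" "B *v w = 0" "\<And>s. w \<bullet> (transpose B *v s) = 0"
proof -
  have sub: "subspace (range (\<lambda>u. transpose B *v u))"
    by (intro linear_subspace_image subspace_UNIV matrix_vector_mul_linear)
  obtain y w where y: "y \<in> span (range (\<lambda>u. transpose B *v u))"
    and w: "\<And>s. s \<in> span (range (\<lambda>u. transpose B *v u)) \<Longrightarrow> orthogonal w s" and v: "v = y + w"
    by (rule orthogonal_subspace_decomp_exists) blast
  have "span (range (\<lambda>u. transpose B *v u)) = range (\<lambda>u. transpose B *v u)"
    using sub by (simp only: span_eq_iff)
  with y obtain u where u: "y = transpose B *v u" by blast
  have orth: "w \<bullet> (transpose B *v s) = 0" for s
    using w[of "transpose B *v s"] by (auto simp: orthogonal_def span_base)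
  have "(B *v w) \<bullet> (B *v w) = 0"
    using orth[of "B *v w"] by (metis inner_commute inner_transpose_mult)
  then show thesis using that u v orth by simp
qed

lemma gram_pos_on_range_transpose:
  fixes B :: "real^'p^'l"
  assumes "v \<in> range (\<lambda>u. transpose B *v u)" "v \<noteq> 0"
  shows "B *v v \<noteq> 0"
proof
  assume z: "B *v v = 0"
  from assms obtain u where u: "v = transpose B *v u" by blast
  have "v \<bullet> v = u \<bullet> (B *v v)" by (simp add: u inner_transpose_mult)
  with z assms show False by simp
qed

text \<open>On the range of \<open>B\<^sup>T\<close> the matrix \<open>B\<close> is injective, so the minimal eigenvalue there is positive. It is
  the least positive one, because an eigenvector \<open>v\<close> for \<open>\<nu> > 0\<close> equals \<open>B\<^sup>T (B v / \<nu>)\<close> and so lies in that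
  range.\<close>

lemma sigma_pos_props:
  fixes B :: "real^'p^'l"
  assumes "B \<noteq> 0"
  shows sigma_pos_pos: "sigma_pos B > 0"
    and sigma_pos_bound: "\<And>u. sigma_pos B * (norm (transpose B *v u))\<^sup>2 \<le> (norm (B *v (transpose B *v u)))\<^sup>2"
proof -
  let ?S = "range (\<lambda>u. transpose B *v u)"
  obtain v where v: "B *v v \<noteq> 0"
    using assms by (auto simp: matrix_eq)
  obtain u w where "v = transpose B *v u + w" "B *v w = 0"
    by (rule range_transpose_cases)
  with v have ne: "transpose B *v u \<noteq> 0"
    by (auto simp: matrix_vector_right_distrib)
  have sub: "subspace ?S"
    by (intro linear_subspace_image subspace_UNIV matrix_vector_mul_linear)
  obtain \<mu> w where w: "w \<in> ?S" "w \<noteq> 0" "transpose B *v (B *v w) = \<mu> *\<^sub>R w"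
    and bound: "\<And>v. v \<in> ?S \<Longrightarrow> \<mu> * (norm v)\<^sup>2 \<le> (norm (B *v v))\<^sup>2"
    by (rule gram_min_eigenpair_on_subspace[OF sub _ ne, of B]) auto
  have ev: "is_eigenvalue (transpose B ** B) \<mu>"
    unfolding is_eigenvalue_def matrix_vector_mul_assoc[symmetric] using w by blast
  have "\<mu> * (norm w)\<^sup>2 = (transpose B *v (B *v w)) \<bullet> w"
    by (simp add: w power2_norm_eq_inner)
  also have "\<dots> = (norm (B *v w))\<^sup>2"
    by (simp add: power2_norm_eq_inner inner_transpose_mult)
  also have "\<dots> > 0"
    using gram_pos_on_range_transpose w by simp
  finally have pos: "\<mu> > 0"
    by (simp add: zero_less_mult_iff)
  have "sigma_pos B = \<mu>"
    unfolding sigma_pos_def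
  proof (rule Least_equality)
    show "is_eigenvalue (transpose B ** B) \<mu> \<and> \<mu> > 0" using ev pos by blast
  next
    fix \<nu> assume \<nu>: "is_eigenvalue (transpose B ** B) \<nu> \<and> \<nu> > 0"
    then obtain v where v: "v \<noteq> 0" "transpose B *v (B *v v) = \<nu> *\<^sub>R v"
      "(norm (B *v v))\<^sup>2 = \<nu> * (norm v)\<^sup>2"
      using gram_eigenvalue_rayleigh by blast
    have "v = transpose B *v ((1 / \<nu>) *\<^sub>R (B *v v))"
      using v(2) \<nu> by (simp add: matrix_vector_mult_scaleR)
    then have "v \<in> ?S" by blast
    from bound[OF this] v show "\<mu> \<le> \<nu>" by simp
  qed
  with pos bound show "sigma_pos B > 0"
    "\<And>u. sigma_pos B * (norm (transpose B *v u))\<^sup>2 \<le> (norm (B *v (transpose B *v u)))\<^sup>2"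
    by auto
qed

text \<open>Represent \<open>\<xi>\<close> as \<open>B z\<close> with \<open>z\<close> in the range of \<open>B\<^sup>T\<close>. Then
  \<open>\<parallel>\<xi>\<parallel>\<^sup>2 = \<langle>B\<^sup>T \<xi>, z\<rangle> \<le> \<parallel>B\<^sup>T \<xi>\<parallel> \<parallel>z\<parallel>\<close>, and \<open>\<parallel>z\<parallel>\<close> is bounded through \<open>sigma_pos_bound\<close>.\<close>

lemma sigma_pos_bound_transpose:
  fixes B :: "real^'p^'l"
  assumes "B \<noteq> 0" "\<xi> \<in> range (\<lambda>v. B *v v)"
  shows "sigma_pos B * (norm \<xi>)\<^sup>2 \<le> (norm (transpose B *v \<xi>))\<^sup>2"
proof -
  obtain v where v: "\<xi> = B *v v" using assms(2) by blast
  obtain u w where uw: "v = transpose B *v u + w" "B *v w = 0"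
    by (rule range_transpose_cases)
  define z where "z = transpose B *v u"
  have \<xi>: "\<xi> = B *v z" using v uw by (simp add: matrix_vector_right_distrib z_def)
  have s: "sigma_pos B > 0" "sigma_pos B * (norm z)\<^sup>2 \<le> (norm \<xi>)\<^sup>2"
    using sigma_pos_props[OF assms(1)] by (auto simp: z_def \<xi>)
  have "(norm \<xi>)\<^sup>2 = (transpose B *v \<xi>) \<bullet> z"
    by (simp add: power2_norm_eq_inner inner_transpose_mult \<xi>)
  also have "\<dots> \<le> norm (transpose B *v \<xi>) * norm z"
    by (rule norm_cauchy_schwarz)
  finally have "((norm \<xi>)\<^sup>2)\<^sup>2 \<le> (norm (transpose B *v \<xi>))\<^sup>2 * (norm z)\<^sup>2"
    by (metis power_mono power_mult_distrib zero_le_power2)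
  then have "sigma_pos B * ((norm \<xi>)\<^sup>2)\<^sup>2 \<le> (norm (transpose B *v \<xi>))\<^sup>2 * (sigma_pos B * (norm z)\<^sup>2)"
    using s(1) by (simp add: mult.left_commute mult_left_mono)
  also have "\<dots> \<le> (norm (transpose B *v \<xi>))\<^sup>2 * (norm \<xi>)\<^sup>2"
    by (intro mult_left_mono s) simp
  finally have "(sigma_pos B * (norm \<xi>)\<^sup>2) * (norm \<xi>)\<^sup>2 \<le> (norm (transpose B *v \<xi>))\<^sup>2 * (norm \<xi>)\<^sup>2"
    by (simp add: power2_eq_square mult.assoc)
  then show ?thesis
    by (cases "\<xi> = 0") auto
qed

section \<open>Projections, gradients and norms\<close>

lemma image_proj_eqI:
  fixes Q :: "real^'n^'m"
  assumes "w \<in> range (\<lambda>z. Q *v z)" "\<And>z. (v - w) \<bullet> (Q *v z) = 0"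
  shows "image_proj Q v = w"
  unfolding image_proj_def
proof (rule the_equality)
  show "w \<in> range (\<lambda>z. Q *v z) \<and> (\<forall>s\<in>range (\<lambda>z. Q *v z). (v - w) \<bullet> s = 0)"
    using assms by auto
next
  fix w' assume w': "w' \<in> range (\<lambda>z. Q *v z) \<and> (\<forall>s\<in>range (\<lambda>z. Q *v z). (v - w') \<bullet> s = 0)"
  from assms(1) w' obtain z z' where "w = Q *v z" "w' = Q *v z'" by auto
  then have d: "w' - w = Q *v (z' - z)" by (simp add: matrix_vector_mult_diff_distrib)
  have "(v - w) \<bullet> (w' - w) = 0" "(v - w') \<bullet> (w' - w) = 0"
    unfolding d using assms(2) w' by auto
  then have "(w' - w) \<bullet> (w' - w) = 0" by (simp add: inner_diff_left)
  then show "w' = w" by simp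
qed

lemma image_proj_props:
  fixes B :: "real^'p^'l"
  shows "image_proj (transpose B) v \<in> range (\<lambda>z. transpose B *v z)"
    and "(v - image_proj (transpose B) v) \<bullet> (transpose B *v s) = 0"
proof -
  obtain u w where uw: "v = transpose B *v u + w" "B *v w = 0"
    "\<And>s. w \<bullet> (transpose B *v s) = 0"
    using range_transpose_cases[of v B] by blast
  then have *: "image_proj (transpose B) v = transpose B *v u"
    by (intro image_proj_eqI) auto
  show "image_proj (transpose B) v \<in> range (\<lambda>z. transpose B *v z)"
    "(v - image_proj (transpose B) v) \<bullet> (transpose B *v s) = 0"
    unfolding * using uw by auto
qed

text \<open>This is how a Lipschitz bound on projected gradients gets used although the gradients themselves
  need not lie in the range of \<open>B\<^sup>T\<close>: the combination does, so projecting loses nothing of it, and the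
  projection does not increase the norm of \<open>e\<close>.\<close>

lemma norm_diff_le_norm_image_proj_diff:
  fixes B :: "real^'p^'l"
  assumes "v - v' + e \<in> range (\<lambda>z. transpose B *v z)"
  shows "norm (v - v' + e)
    \<le> norm (image_proj (transpose B) v - image_proj (transpose B) v') + norm e"
proof -
  let ?P = "image_proj (transpose B)"
  obtain a where a: "v - v' + e = transpose B *v a" using assms by blast
  have "(v - v' + e) \<bullet> (v - v' + e) = (v - v' + e) \<bullet> (transpose B *v a)" by (simp add: a)
  also have "\<dots> = (?P v - ?P v' + e) \<bullet> (transpose B *v a)"
    using image_proj_props(2)[of v B a] image_proj_props(2)[of v' B a]
    by (simp add: inner_add_left inner_diff_left)
  also have "\<dots> \<le> norm (?P v - ?P v' + e) * norm (v - v' + e)"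
    unfolding a by (rule norm_cauchy_schwarz)
  finally have "norm (v - v' + e) * norm (v - v' + e) \<le> norm (?P v - ?P v' + e) * norm (v - v' + e)"
    by (simp add: power2_norm_eq_inner[symmetric] power2_eq_square)
  then have "norm (v - v' + e) \<le> norm (?P v - ?P v' + e)"
    by (cases "v - v' + e = 0") auto
  then show ?thesis using norm_triangle_ineq[of "?P v - ?P v'" e] by linarith
qed

lemma grad_GDERIV:
  fixes g :: "'a::euclidean_space \<Rightarrow> real"
  assumes "g differentiable (at v)"
  shows "GDERIV g v :> grad g v"
proof -
  obtain g' where g': "(g has_derivative g') (at v)"
    using assms by (auto simp: differentiable_def)
  interpret linear g' using g' by (rule has_derivative_linear)
  define D where "D = (\<Sum>i\<in>Basis. g' i *\<^sub>R i)"
  have "g' h = h \<bullet> D" for h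
  proof -
    have "g' h = g' (\<Sum>i\<in>Basis. (h \<bullet> i) *\<^sub>R i)" by (simp add: euclidean_representation)
    also have "\<dots> = h \<bullet> D" by (simp add: sum scale D_def inner_sum_right mult.commute)
    finally show ?thesis .
  qed
  then have "g' = (\<lambda>h. h \<bullet> D)" by blast
  then have D: "GDERIV g v :> D" using g' unfolding gderiv_def by simp
    have unique: "D' = D" if "GDERIV g v :> D'" for D'
  proof -
    have "(\<lambda>h. h \<bullet> D') = (\<lambda>h. h \<bullet> D)"
      using that D unfolding gderiv_def by (rule has_derivative_unique)
    then have "D' \<bullet> (D' - D) = D \<bullet> (D' - D)" by (metis inner_commute)
    then have "(D' - D) \<bullet> (D' - D) = 0" by (simp add: inner_diff_left)
    then show ?thesis by simp
  qed
  from D unique show ?thesis unfolding grad_def by (rule theI)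
qed

lemma matrix_norm_mult_le: "norm (M *v v) \<le> matrix_norm M * norm v" for M :: "real^'n^'m"
  unfolding matrix_norm_def by (intro onorm matrix_vector_mul_bounded_linear)

lemma seminorm_of_power2:
  assumes "pos_semidef G"
  shows "(seminorm_of G v)\<^sup>2 = (G *v v) \<bullet> v"
  using assms by (auto simp: seminorm_of_def pos_semidef_def)

section \<open>Optimality and descent in the two minimization steps\<close>

text \<open>The difference quotient is at least \<open>- C \<parallel>y - x\<parallel>\<close>, which tends to 0.\<close>

lemma frechet_subdiffI_quadratic_minorant:
  fixes h :: "'a::real_inner \<Rightarrow> ereal"
  assumes hx: "h x = ereal r"
    and minorant: "\<And>d. ereal (r + u \<bullet> d - C * (norm d)\<^sup>2) \<le> h (x + d)"
  shows "u \<in> frechet_subdiff h x"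
proof -
  let ?Q = "\<lambda>y. (h y - h x - ereal (u \<bullet> (y - x))) / ereal (norm (y - x))"
  have quotient: "ereal (- C * norm (y - x)) \<le> ?Q y" if "y \<noteq> x" for y
  proof -
    have n: "norm (y - x) > 0" using that by simp
    have m: "ereal (r + u \<bullet> (y - x) - C * (norm (y - x))\<^sup>2) \<le> h y"
      using minorant[of "y - x"] by simp
    show ?thesis
    proof (cases "h y")
      case (real s)
      with m have "- C * (norm (y - x) * norm (y - x)) \<le> s - r - u \<bullet> (y - x)"
        by (simp add: power2_eq_square)
      with n have "- C * norm (y - x) \<le> (s - r - u \<bullet> (y - x)) / norm (y - x)"
        by (simp add: pos_le_divide_eq mult.assoc)
      with n real hx show ?thesis by simp
    qed (use n m hx in auto)
  qed
  have "0 \<le> Liminf (at x) ?Q"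
    unfolding le_Liminf_iff
  proof (intro allI impI)
    fix c :: ereal assume "c < 0"
    then obtain z where z: "c < ereal z" "z < 0"
      using ereal_dense2[of c 0] by (auto simp: zero_ereal_def)
    have "\<forall>\<^sub>F y in at x. y \<noteq> x \<and> dist y x < - z / (\<bar>C\<bar> + 1)"
      unfolding eventually_at using z by (intro exI[of _ "- z / (\<bar>C\<bar> + 1)"]) (auto simp: divide_simps)
    then show "\<forall>\<^sub>F y in at x. c < ?Q y"
    proof (rule eventually_mono)
      fix y assume y: "y \<noteq> x \<and> dist y x < - z / (\<bar>C\<bar> + 1)"
      then have "norm (y - x) * (\<bar>C\<bar> + 1) < - z"
        by (metis dist_norm abs_ge_zero add_nonneg_pos pos_less_divide_eq zero_less_one)
      moreover have "C * norm (y - x) \<le> norm (y - x) * (\<bar>C\<bar> + 1)"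
        using mult_right_mono[of C "\<bar>C\<bar> + 1" "norm (y - x)"] by (simp add: mult.commute)
      ultimately have "ereal z < ereal (- C * norm (y - x))" by simp
      with z quotient y show "c < ?Q y"
        by (meson less_le_trans less_trans)
    qed
  qed
  with hx show ?thesis by (simp add: frechet_subdiff_def)
qed

lemma frechet_subdiff_subset_lim_subdiff: "frechet_subdiff h x \<subseteq> lim_subdiff h x"
proof
  fix u assume u: "u \<in> frechet_subdiff h x"
  then have "h x < \<infinity>" by (auto simp: frechet_subdiff_def split: if_splits)
  with u show "u \<in> lim_subdiff h x"
    unfolding lim_subdiff_def
    by (simp, intro exI[of _ "\<lambda>_. x"] conjI exI[of _ "\<lambda>_. u"]) simp_all
qed

lemma proper_finite_at_minimizer:
  fixes r :: "'a \<Rightarrow> real"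
  assumes "proper f" "\<And>u. f x + ereal (r x) \<le> f u + ereal (r u)"
  obtains a where "f x = ereal a"
proof -
  obtain u where "f u \<noteq> \<infinity>" using assms(1) by (auto simp: proper_def)
  with assms(2)[of u] have "f x \<noteq> \<infinity>" by auto
  moreover have "f x \<noteq> -\<infinity>" using assms(1) by (auto simp: proper_def)
  ultimately show thesis using that by (cases "f x") auto
qed

lemma norm_add_power2: "(norm (a + b))\<^sup>2 = (norm a)\<^sup>2 + 2 * (a \<bullet> b) + (norm b)\<^sup>2"
  for a b :: "'a::real_inner"
  by (simp add: power2_norm_eq_inner inner_add inner_commute)

text \<open>Let \<open>q\<close> collect the finite terms of the objective. Minimality gives \<open>f (x + d) \<ge> f x - (q (x + d) - q x)\<close>,
  and since \<open>q\<close> is quadratic the right-hand side is the required minorant of \<open>f\<close>.\<close>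

lemma x_step_subdiff:
  fixes A :: "real^'n^'l" and B :: "real^'p^'l"
  assumes f: "proper f" and G: "pos_semidef G" and \<beta>: "\<beta> \<ge> 0"
    and min: "\<And>u. aug_lagrangian f g A B b \<beta> x y lam + ereal (1/2 * (seminorm_of G (x - x'))\<^sup>2)
      \<le> aug_lagrangian f g A B b \<beta> u y lam + ereal (1/2 * (seminorm_of G (u - x'))\<^sup>2)"
  shows "transpose A *v (lam - \<beta> *\<^sub>R (A *v x + B *v y - b)) - G *v (x - x') \<in> frechet_subdiff f x"
proof -
  define \<rho> where "\<rho> = A *v x + B *v y - b"
  define q where "q u = g y - lam \<bullet> (A *v u + B *v y - b) + \<beta> / 2 * (norm (A *v u + B *v y - b))\<^sup>2
    + 1/2 * ((G *v (u - x')) \<bullet> (u - x'))" for u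
  have min': "f x + ereal (q x) \<le> f u + ereal (q u)" for u
    using min[of u] by (simp add: aug_lagrangian_def q_def seminorm_of_power2[OF G] add.assoc)
  then obtain a where a: "f x = ereal a"
    by (rule proper_finite_at_minimizer[OF f])
  define u where "u = transpose A *v (lam - \<beta> *\<^sub>R \<rho>) - G *v (x - x')"
  define C where "C = \<beta> / 2 * (matrix_norm A)\<^sup>2 + 1/2 * matrix_norm G"
  have q: "q (x + d) = q x - u \<bullet> d + \<beta> / 2 * (norm (A *v d))\<^sup>2 + 1/2 * ((G *v d) \<bullet> d)" for d
  proof -
    have r: "A *v (x + d) + B *v y - b = \<rho> + A *v d"
      by (simp add: \<rho>_def matrix_vector_right_distrib)
    have "(G *v d) \<bullet> (x - x') = (G *v (x - x')) \<bullet> d"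
      using inner_transpose_mult[of G d "x - x'"] G by (simp add: pos_semidef_def inner_commute)
    moreover have "G *v (x + d - x') = G *v (x - x') + G *v d"
      by (simp add: matrix_vector_right_distrib matrix_vector_mult_diff_distrib)
    moreover have "x + d - x' = (x - x') + d" by simp
    ultimately have g: "(G *v (x + d - x')) \<bullet> (x + d - x')
        = (G *v (x - x')) \<bullet> (x - x') + 2 * ((G *v (x - x')) \<bullet> d) + (G *v d) \<bullet> d"
      by (simp only: inner_add_left inner_add_right)
    have ud: "u \<bullet> d = lam \<bullet> (A *v d) - \<beta> * (\<rho> \<bullet> (A *v d)) - (G *v (x - x')) \<bullet> d"
      by (simp add: u_def inner_diff_left inner_transpose_mult)
    show ?thesis
      unfolding q_def r g ud norm_add_power2 inner_add_right \<rho>_def[symmetric]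
      by (simp add: algebra_simps)
  qed
  have "u \<in> frechet_subdiff f x"
  proof (rule frechet_subdiffI_quadratic_minorant[where h = f and x = x and r = a and u = u and C = C, OF a])
    fix d
    have "(norm (A *v d))\<^sup>2 \<le> (matrix_norm A)\<^sup>2 * (norm d)\<^sup>2"
      using power_mono[OF matrix_norm_mult_le norm_ge_zero, of A d 2] by (simp add: power_mult_distrib)
    then have 1: "\<beta> / 2 * (norm (A *v d))\<^sup>2 \<le> \<beta> / 2 * ((matrix_norm A)\<^sup>2 * (norm d)\<^sup>2)"
      using \<beta> by (intro mult_left_mono) auto
    have "(G *v d) \<bullet> d \<le> norm (G *v d) * norm d" by (rule norm_cauchy_schwarz)
    also have "\<dots> \<le> matrix_norm G * (norm d)\<^sup>2"
      using mult_right_mono[OF matrix_norm_mult_le norm_ge_zero, of G d d]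
      by (simp add: power2_eq_square mult.assoc)
    finally have "q (x + d) - q x \<le> - (u \<bullet> d) + C * (norm d)\<^sup>2"
      using 1 unfolding q C_def by (simp add: algebra_simps)
    then show "ereal (a + u \<bullet> d - C * (norm d)\<^sup>2) \<le> f (x + d)"
      using min'[of "x + d"] a by (cases "f (x + d)") auto
  qed
  then show ?thesis by (simp add: u_def \<rho>_def)
qed

lemma y_step_gradient:
  fixes B :: "real^'p^'l" and y' :: "real^'p"
  assumes g: "g differentiable (at y)"
    and min: "\<And>v. g y - lam \<bullet> (a + B *v y - b) + \<beta> / 2 * (norm (a + B *v y - b))\<^sup>2 + \<tau> / 2 * (norm (y - y'))\<^sup>2
      \<le> g v - lam \<bullet> (a + B *v v - b) + \<beta> / 2 * (norm (a + B *v v - b))\<^sup>2 + \<tau> / 2 * (norm (v - y'))\<^sup>2"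
  shows "grad g y = transpose B *v (lam - \<beta> *\<^sub>R (a + B *v y - b)) - \<tau> *\<^sub>R (y - y')"
proof -
  define \<rho> where "\<rho> = a + B *v y - b"
  define D where "D = grad g y - transpose B *v (lam - \<beta> *\<^sub>R \<rho>) + \<tau> *\<^sub>R (y - y')"
  let ?\<phi> = "\<lambda>v. g v - lam \<bullet> (a + B *v v - b) + \<beta> / 2 * (norm (a + B *v v - b))\<^sup>2
    + \<tau> / 2 * (norm (v - y'))\<^sup>2"
  have g': "(g has_derivative (\<lambda>h. h \<bullet> grad g y)) (at y)"
    using grad_GDERIV[OF g] by (simp add: gderiv_def)
  have B: "((\<lambda>v. a + B *v v - b) has_derivative (\<lambda>h. B *v h)) (at y)"
    by (auto intro!: derivative_eq_intros bounded_linear_imp_has_derivative)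
  have B2: "((\<lambda>v. (norm (a + B *v v - b))\<^sup>2) has_derivative (\<lambda>h. 2 * (\<rho> \<bullet> (B *v h)))) (at y)"
    using has_derivative_inner[OF B B] by (simp add: power2_norm_eq_inner \<rho>_def inner_commute)
  have y: "((\<lambda>v. v - y') has_derivative (\<lambda>h. h)) (at y)"
    by (auto intro!: derivative_eq_intros)
  have y2: "((\<lambda>v. (norm (v - y'))\<^sup>2) has_derivative (\<lambda>h. 2 * ((y - y') \<bullet> h))) (at y)"
    using has_derivative_inner[OF y y] by (simp add: power2_norm_eq_inner inner_commute)
  have "(?\<phi> has_derivative (\<lambda>h. h \<bullet> grad g y - lam \<bullet> (B *v h)
      + \<beta> / 2 * (2 * (\<rho> \<bullet> (B *v h))) + \<tau> / 2 * (2 * ((y - y') \<bullet> h)))) (at y)"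
    by (intro has_derivative_add has_derivative_diff has_derivative_mult_right
        has_derivative_inner_right g' B B2 y2)
  moreover have "h \<bullet> grad g y - lam \<bullet> (B *v h) + \<beta> / 2 * (2 * (\<rho> \<bullet> (B *v h)))
      + \<tau> / 2 * (2 * ((y - y') \<bullet> h)) = h \<bullet> D" for h
    by (simp add: D_def inner_add_right inner_diff_right inner_mult_transpose inner_commute)
  ultimately have "(?\<phi> has_derivative (\<lambda>h. h \<bullet> D)) (at y)"
    by (simp only:)
  from has_derivative_local_min[OF this] min
  have "(\<lambda>h. h \<bullet> D) = (\<lambda>h. 0)" by simp
  then have "D \<bullet> D = 0" by metis
  then have "D = 0" by simp
  then show ?thesis unfolding D_def \<rho>_def by (simp add: diff_add_eq eq_diff_eq)
qed

text \<open>Along the segment from the minimizer \<open>y\<close> to \<open>v\<close> the quadratic terms obey the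
  convexity inequality with the exact gain \<open>t (1 - t) / 2 \<cdot> (\<beta> \<parallel>B d\<parallel>\<^sup>2 + \<tau> \<parallel>d\<parallel>\<^sup>2)\<close>, and the weak
  convexity of \<open>g\<close> costs at most \<open>t (1 - t) / 2 \<cdot> m \<parallel>d\<parallel>\<^sup>2\<close>. Dividing by \<open>t\<close> and letting
  \<open>t\<close> tend to 0 gives quadratic growth.\<close>

lemma y_step_descent:
  fixes B :: "real^'p^'l" and y' :: "real^'p"
  assumes conv: "convex_on UNIV (\<lambda>v. g v + m / 2 * (norm v)\<^sup>2)" and \<beta>: "\<beta> \<ge> 0"
    and min: "\<And>v. g y - lam \<bullet> (a + B *v y - b) + \<beta> / 2 * (norm (a + B *v y - b))\<^sup>2 + \<tau> / 2 * (norm (y - y'))\<^sup>2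
      \<le> g v - lam \<bullet> (a + B *v v - b) + \<beta> / 2 * (norm (a + B *v v - b))\<^sup>2 + \<tau> / 2 * (norm (v - y'))\<^sup>2"
  shows "g y - lam \<bullet> (a + B *v y - b) + \<beta> / 2 * (norm (a + B *v y - b))\<^sup>2 + \<tau> / 2 * (norm (y - y'))\<^sup>2
      + (\<beta> * sigma_min B + \<tau> - m) / 2 * (norm (v - y))\<^sup>2
      \<le> g v - lam \<bullet> (a + B *v v - b) + \<beta> / 2 * (norm (a + B *v v - b))\<^sup>2 + \<tau> / 2 * (norm (v - y'))\<^sup>2"
proof -
  define \<phi> where "\<phi> v = g v - lam \<bullet> (a + B *v v - b) + \<beta> / 2 * (norm (a + B *v v - b))\<^sup>2
    + \<tau> / 2 * (norm (v - y'))\<^sup>2" for v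
  define d where "d = v - y"
  define \<kappa> where "\<kappa> = \<beta> * (norm (B *v d))\<^sup>2 + (\<tau> - m) * (norm d)\<^sup>2"
  have segment: "(norm (p + t *\<^sub>R q))\<^sup>2 = (1 - t) * (norm p)\<^sup>2 + t * (norm (p + q))\<^sup>2 - t * (1 - t) * (norm q)\<^sup>2"
    for p q :: "'z::real_inner" and t :: real
    unfolding norm_add_power2
    by (simp add: power_mult_distrib algebra_simps power2_eq_square)
  have along: "(1 - t) / 2 * \<kappa> \<le> \<phi> v - \<phi> y" if t: "0 < t" "t \<le> 1" for t
  proof -
    have v: "v = y + d" by (simp add: d_def)
    have "(1 - t) *\<^sub>R y + t *\<^sub>R v = y + t *\<^sub>R d" by (simp add: v algebra_simps)
    then have c: "g (y + t *\<^sub>R d) + m / 2 * (norm (y + t *\<^sub>R d))\<^sup>2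
        \<le> (1 - t) * (g y + m / 2 * (norm y)\<^sup>2) + t * (g (y + d) + m / 2 * (norm (y + d))\<^sup>2)"
      using convex_onD[OF conv, of t y v] t by (simp add: v)
    define r where "r = a + B *v y - b"
    have r: "a + B *v (y + t *\<^sub>R d) - b = r + t *\<^sub>R (B *v d)" "a + B *v (y + d) - b = r + B *v d"
      by (simp_all add: r_def matrix_vector_right_distrib matrix_vector_mult_scaleR)
    have s: "y + t *\<^sub>R d - y' = (y - y') + t *\<^sub>R d" "y + d - y' = (y - y') + d" by simp_all
    have "\<phi> (y + t *\<^sub>R d) \<le> (1 - t) * \<phi> y + t * \<phi> (y + d) - t * (1 - t) / 2 * \<kappa>"
      using c unfolding \<phi>_def \<kappa>_def r s segment[of y] segment[of "y - y'"] segment[of r]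
      unfolding r_def[symmetric] inner_add_right
      by (simp add: algebra_simps add_divide_distrib diff_divide_distrib)
    moreover have "\<phi> y \<le> \<phi> (y + t *\<^sub>R d)"
      unfolding \<phi>_def by (rule min)
    ultimately have "t * ((1 - t) / 2 * \<kappa>) \<le> t * (\<phi> v - \<phi> y)"
      by (simp add: v algebra_simps)
    with t show ?thesis by simp
  qed
  have "\<kappa> / 2 \<le> \<phi> v - \<phi> y"
  proof (rule tendsto_upperbound)
    show "((\<lambda>t. (1 - t) / 2 * \<kappa>) \<longlongrightarrow> \<kappa> / 2) (at_right 0)"
      by (auto intro!: tendsto_eq_intros)
    show "\<forall>\<^sub>F t in at_right 0. (1 - t) / 2 * \<kappa> \<le> \<phi> v - \<phi> y"
      using along eventually_at_right_less[of 0] eventually_at_right[of 0 1 "\<lambda>t. t \<le> 1"]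
      by (metis (no_types, lifting) eventually_at_right_field less_imp_le zero_less_one)
  qed simp
  moreover have "(\<beta> * sigma_min B + \<tau> - m) * (norm d)\<^sup>2 \<le> \<kappa>"
    using mult_left_mono[OF sigma_min_bound[of B d] \<beta>] by (simp add: \<kappa>_def algebra_simps)
  ultimately have "\<phi> y + (\<beta> * sigma_min B + \<tau> - m) / 2 * (norm d)\<^sup>2 \<le> \<phi> v"
    by simp
  then show ?thesis
    by (simp only: \<phi>_def d_def)
qed

section \<open>Two facts about recursions\<close>

text \<open>With \<open>q = \<bar>\<theta> - 1\<bar>\<close>, the norm of \<open>w\<close> is at most the convex combination \<open>q \<parallel>w'\<parallel> + (1 - q) s\<close> with
  \<open>s = \<theta> \<parallel>u\<parallel> / (1 - q)\<close>, and squaring is convex.\<close>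

lemma relaxed_recursion_bound:
  fixes w w' u :: "'a::real_normed_vector"
  assumes \<theta>: "0 < \<theta>" "\<theta> < 2" and w: "w = (1 - \<theta>) *\<^sub>R w' + \<theta> *\<^sub>R u"
  shows "(norm w)\<^sup>2 \<le> \<bar>\<theta> - 1\<bar> * (norm w')\<^sup>2 + \<theta>\<^sup>2 / (1 - \<bar>\<theta> - 1\<bar>) * (norm u)\<^sup>2"
proof -
  define q where "q = \<bar>\<theta> - 1\<bar>"
  have q: "0 \<le> q" "q < 1" using \<theta> by (auto simp: q_def)
  define s where "s = \<theta> / (1 - q) * norm u"
  have "norm w \<le> norm ((1 - \<theta>) *\<^sub>R w') + norm (\<theta> *\<^sub>R u)" unfolding w by (rule norm_triangle_ineq)
  also have "\<dots> = q * norm w' + (1 - q) * s"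
    using \<theta> q by (simp add: q_def[symmetric] s_def abs_minus_commute[of 1 \<theta>])
  finally have "(norm w)\<^sup>2 \<le> (q * norm w' + (1 - q) * s)\<^sup>2" by (intro power_mono) auto
  also have "\<dots> = q * (norm w')\<^sup>2 + (1 - q) * s\<^sup>2 - q * (1 - q) * (norm w' - s)\<^sup>2"
    by (simp add: power2_eq_square algebra_simps)
  also have "\<dots> \<le> q * (norm w')\<^sup>2 + (1 - q) * s\<^sup>2" using q by simp
  also have "(1 - q) * s\<^sup>2 = \<theta>\<^sup>2 / (1 - q) * (norm u)\<^sup>2"
    using q by (simp add: s_def power_mult_distrib power_divide power2_eq_square)
  finally show ?thesis by (simp add: q_def)
qed

text \<open>Below \<open>l\<close>, monotonicity would make \<open>e\<close> lose at least \<open>l - \<Phi> k\<close> at every later step, contradicting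
  \<open>e \<ge> 0\<close>.\<close>

lemma antimono_bounded_below_by_telescoping:
  fixes \<Phi> e :: "nat \<Rightarrow> real"
  assumes anti: "\<And>k. \<Phi> (Suc k) \<le> \<Phi> k" and nonneg: "\<And>k. 0 \<le> e k"
    and tele: "\<And>k. e (Suc k) - e k \<le> \<Phi> (Suc k) - l"
  shows "l \<le> \<Phi> k"
proof (rule ccontr)
  assume "\<not> l \<le> \<Phi> k"
  then have c: "0 < l - \<Phi> k" by simp
  have "\<Phi> (k + n) \<le> \<Phi> k" for n by (induction n) (auto intro: order_trans[OF anti])
  then have step: "e (Suc (k + n)) \<le> e (k + n) - (l - \<Phi> k)" for n
    using tele[of "k + n"] anti by (smt (verit) add_Suc_right)
  have "e (k + n) \<le> e k - real n * (l - \<Phi> k)" for n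
  proof (induction n)
    case (Suc n)
    with step[of n] show ?case by (simp add: algebra_simps)
  qed simp
  moreover obtain n where "e k < real n * (l - \<Phi> k)"
    using reals_Archimedean3[OF c] by blast
  ultimately show False using nonneg[of "k + n"] by (smt (verit))
qed

section \<open>The steps of the proximal ADMM\<close>

lemma proximal_admmD:
  assumes "proximal_admm f g A B b G \<theta> \<beta> \<tau> x y lam"
  shows proximal_admm_x_min:
      "aug_lagrangian f g A B b \<beta> (x (Suc k)) (y k) (lam k) + ereal (1/2 * (seminorm_of G (x (Suc k) - x k))\<^sup>2)
        \<le> aug_lagrangian f g A B b \<beta> u (y k) (lam k) + ereal (1/2 * (seminorm_of G (u - x k))\<^sup>2)"
    and proximal_admm_y_min:
      "aug_lagrangian f g A B b \<beta> (x (Suc k)) (y (Suc k)) (lam k) + ereal (\<tau>/2 * (norm (y (Suc k) - y k))\<^sup>2)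
        \<le> aug_lagrangian f g A B b \<beta> (x (Suc k)) v (lam k) + ereal (\<tau>/2 * (norm (v - y k))\<^sup>2)"
    and proximal_admm_multiplier:
      "lam (Suc k) - lam k = - (\<theta> * \<beta>) *\<^sub>R (A *v x (Suc k) + B *v y (Suc k) - b)"
  using assms[unfolded proximal_admm_def is_arg_min_linorder, THEN spec, of "Suc k"] by auto

text \<open>The proximal step lands in the domain of \<open>f\<close> even if it starts outside: a proper \<open>f\<close> offers a
  competitor of finite value.\<close>

lemma proximal_admm_f_finite:
  assumes "proximal_admm f g A B b G \<theta> \<beta> \<tau> x y lam" "proper f"
  obtains a where "f (x (Suc k)) = ereal a"
proof (rule proper_finite_at_minimizer[OF assms(2)])
  let ?r = "\<lambda>u. g (y k) - lam k \<bullet> (A *v u + B *v y k - b) + \<beta> / 2 * (norm (A *v u + B *v y k - b))\<^sup>2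
      + 1/2 * (seminorm_of G (u - x k))\<^sup>2"
  fix u show "f (x (Suc k)) + ereal (?r (x (Suc k))) \<le> f u + ereal (?r u)"
    using proximal_admm_x_min[OF assms(1), of k u] by (simp add: aug_lagrangian_def add.assoc)
qed

lemma proximal_admm_y_min_real:
  assumes "proximal_admm f g A B b G \<theta> \<beta> \<tau> x y lam" "proper f"
  shows "g (y (Suc k)) - lam k \<bullet> (A *v x (Suc k) + B *v y (Suc k) - b)
      + \<beta> / 2 * (norm (A *v x (Suc k) + B *v y (Suc k) - b))\<^sup>2 + \<tau> / 2 * (norm (y (Suc k) - y k))\<^sup>2
    \<le> g v - lam k \<bullet> (A *v x (Suc k) + B *v v - b)
      + \<beta> / 2 * (norm (A *v x (Suc k) + B *v v - b))\<^sup>2 + \<tau> / 2 * (norm (v - y k))\<^sup>2"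
proof -
  obtain a where "f (x (Suc k)) = ereal a"
    using proximal_admm_f_finite[OF assms] by blast
  with proximal_admm_y_min[OF assms(1), of k v] show ?thesis
    by (simp add: aug_lagrangian_def)
qed

lemma proximal_admm_gradient:
  assumes "proximal_admm f g A B b G \<theta> \<beta> \<tau> x y lam" "proper f" "g differentiable (at (y (Suc k)))"
  shows "grad g (y (Suc k)) = transpose B *v (lam k - \<beta> *\<^sub>R (A *v x (Suc k) + B *v y (Suc k) - b))
    - \<tau> *\<^sub>R (y (Suc k) - y k)"
  by (intro y_step_gradient assms proximal_admm_y_min_real[OF assms(1,2)])

text \<open>The predicted multiplier uses \<open>y k\<close> where the optimality condition of the \<open>y\<close>-step has \<open>y (Suc k)\<close>; the
  mismatch is \<open>\<beta> B\<^sup>T B\<close> applied to the increment, next to the proximal term.\<close>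

lemma proximal_admm_dual_residual:
  fixes A :: "real^'n^'l" and B :: "real^'p^'l"
  assumes "proximal_admm f g A B b G \<theta> \<beta> \<tau> x y lam" "proper f" "g differentiable (at (y (Suc k)))"
    and "0 \<le> \<beta>" "0 \<le> \<tau>"
  shows "norm (grad g (y (Suc k)) - transpose B *v (lam k - \<beta> *\<^sub>R (A *v x (Suc k) + B *v y k - b)))
    \<le> (\<beta> * matrix_norm (transpose B ** B) + \<tau>) * norm (y (Suc k) - y k)"
proof -
  let ?d = "y (Suc k) - y k"
  have "B *v y (Suc k) = B *v y k + B *v ?d"
    by (simp add: matrix_vector_mult_diff_distrib)
  then have "grad g (y (Suc k)) - transpose B *v (lam k - \<beta> *\<^sub>R (A *v x (Suc k) + B *v y k - b))
      = - (\<beta> *\<^sub>R ((transpose B ** B) *v ?d)) - \<tau> *\<^sub>R ?d"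
    unfolding proximal_admm_gradient[OF assms(1-3)]
    by (simp add: matrix_vector_mult_diff_distrib matrix_vector_right_distrib
        matrix_vector_mult_scaleR matrix_vector_mul_assoc algebra_simps)
  also have "norm \<dots> \<le> \<beta> * norm ((transpose B ** B) *v ?d) + \<tau> * norm ?d"
    using norm_triangle_ineq4[of "- (\<beta> *\<^sub>R ((transpose B ** B) *v ?d))" "\<tau> *\<^sub>R ?d"] assms(4,5) by simp
  also have "\<dots> \<le> \<beta> * (matrix_norm (transpose B ** B) * norm ?d) + \<tau> * norm ?d"
    using assms(4) by (intro add_right_mono mult_left_mono matrix_norm_mult_le)
  finally show ?thesis by (simp add: algebra_simps)
qed

section \<open>The potential and its decrease\<close>

text \<open>A run with finite initial value \<open>f (x 0)\<close>, for which all values are real. The sequences \<open>dy\<close> and \<open>dlam\<close>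
  are the increments of \<open>y\<close> and \<open>lam\<close>, extended to index 0 by a pair that is feasible for \<open>\<eta>0\<close>.\<close>

locale finite_proximal_admm_run =
  fixes f :: "real^'n \<Rightarrow> ereal" and g :: "real^'p \<Rightarrow> real"
    and A :: "real^'n^'l" and B :: "real^'p^'l" and b :: "real^'l" and G :: "real^'n^'n"
    and L m \<theta> \<beta> \<tau> :: real
    and x :: "nat \<Rightarrow> real^'n" and y :: "nat \<Rightarrow> real^'p" and lam :: "nat \<Rightarrow> real^'l"
    and F :: "nat \<Rightarrow> real" and l :: real
    and dy :: "nat \<Rightarrow> real^'p" and dlam :: "nat \<Rightarrow> real^'l"
  assumes f_proper: "proper f" and F: "\<And>k. f (x k) = ereal (F k)"
    and B_nonzero: "B \<noteq> 0"
    and range_B: "insert b (range (\<lambda>u. A *v u)) \<subseteq> range (\<lambda>v. B *v v)"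
    and g_diff: "\<And>v. g differentiable (at v)"
    and grad_lipschitz: "\<And>v v'. norm (image_proj (transpose B) (grad g v') - image_proj (transpose B) (grad g v))
                \<le> L * norm (v' - v)"
    and weakly_convex: "convex_on UNIV (\<lambda>v. g v + m / 2 * (norm v)\<^sup>2)"
    and \<theta>: "0 < \<theta>" "\<theta> < 2" and \<beta>: "0 < \<beta>" and \<tau>: "0 \<le> \<tau>"
    and delta1_pos: "0 < delta1 B L m \<theta> \<beta> \<tau>"
    and admm: "proximal_admm f g A B b G \<theta> \<beta> \<tau> x y lam"
    and below: "\<And>k. l \<le> F k + g (y k) + \<beta> / 2 * (norm (A *v x k + B *v y k - b))\<^sup>2"
    and dy_Suc: "\<And>k. dy (Suc k) = y (Suc k) - y k"
    and dlam_Suc: "\<And>k. dlam (Suc k) = lam (Suc k) - lam k"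
    and initial_increments:
      "\<tau> *\<^sub>R dy 0 + (1 - 1/\<theta>) *\<^sub>R (transpose B *v dlam 0) = transpose B *v lam 0 - grad g (y 0)"
begin

definition res :: "nat \<Rightarrow> real^'l" where "res k = A *v x k + B *v y k - b"

text \<open>The contraction factor of the multiplier recursion.\<close>

definition damp :: real where "damp = \<bar>\<theta> - 1\<bar>"

text \<open>The modulus of strong convexity guaranteed for the objective of the \<open>y\<close>-step.\<close>

definition curv :: real where "curv = \<beta> * sigma_min B + \<tau> - m"

text \<open>The price in the Lagrangian, through the multiplier step, of one unit of \<open>\<parallel>dy\<parallel>\<^sup>2\<close>.\<close>

definition coupling :: real where "coupling = 3 * gamma_const \<theta> * (L\<^sup>2 + \<tau>\<^sup>2) / (\<beta> * sigma_pos B)"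

definition lagr :: "nat \<Rightarrow> real" where
  "lagr k = F k + g (y k) - lam k \<bullet> res k + \<beta> / 2 * (norm (res k))\<^sup>2"

abbreviation (input) dual_sq :: "nat \<Rightarrow> real" where "dual_sq k \<equiv> (norm (transpose B *v dlam k))\<^sup>2"

definition pot :: "nat \<Rightarrow> real" where
  "pot k = lagr k + c1_const B \<theta> \<beta> / 2 * dual_sq k + curv / 4 * (norm (dy k))\<^sup>2"

lemma damp: "0 \<le> damp" "damp < 1"
  using \<theta> by (auto simp: damp_def)

lemma delta1_eq: "delta1 B L m \<theta> \<beta> \<tau> = curv / 4 - coupling"
  by (simp add: delta1_def curv_def coupling_def)

lemma coupling_nonneg: "0 \<le> coupling"
  using \<theta> \<beta> sigma_pos_pos[OF B_nonzero] by (simp add: coupling_def gamma_const_def)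

lemma curv_pos: "0 < curv"
  using delta1_pos coupling_nonneg by (simp add: delta1_eq)

lemma c1_nonneg: "0 \<le> c1_const B \<theta> \<beta>"
  using \<theta> \<beta> damp sigma_pos_pos[OF B_nonzero] by (simp add: c1_const_def damp_def)

lemma dlam_res: "dlam (Suc k) = - (\<theta> * \<beta>) *\<^sub>R res (Suc k)"
  using proximal_admm_multiplier[OF admm] by (simp add: dlam_Suc res_def)

text \<open>For \<open>k > 0\<close> this is the optimality condition of the \<open>y\<close>-step with \<open>lam (k-1)\<close> eliminated by the
  multiplier update. The constraint in the definition of \<open>\<eta>0\<close> is what makes it hold for \<open>k = 0\<close>.\<close>

lemma multiplier_identity:
  "transpose B *v lam k = grad g (y k) + \<tau> *\<^sub>R dy k + (1 - 1/\<theta>) *\<^sub>R (transpose B *v dlam k)"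
proof (cases k)
  case 0
  with initial_increments show ?thesis by (simp add: algebra_simps)
next
  case (Suc j)
  have "lam j - \<beta> *\<^sub>R res (Suc j) = lam (Suc j) - (1 - 1/\<theta>) *\<^sub>R dlam (Suc j)"
  proof -
    have "(1/\<theta>) *\<^sub>R dlam (Suc j) = - \<beta> *\<^sub>R res (Suc j)" using \<theta> by (simp add: dlam_res)
    moreover have "lam (Suc j) = lam j + dlam (Suc j)" by (simp add: dlam_Suc)
    ultimately show ?thesis by (simp add: algebra_simps)
  qed
  then have "grad g (y (Suc j)) = transpose B *v (lam (Suc j) - (1 - 1/\<theta>) *\<^sub>R dlam (Suc j)) - \<tau> *\<^sub>R dy (Suc j)"
    using proximal_admm_gradient[OF admm f_proper g_diff, of j] by (simp add: res_def dy_Suc)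
  with Suc show ?thesis
    by (simp add: matrix_vector_mult_diff_distrib matrix_vector_mult_scaleR)
qed

text \<open>The inhomogeneous term of the recursion for \<open>B\<^sup>T dlam\<close>.\<close>

definition drift :: "nat \<Rightarrow> real^'p" where
  "drift k = grad g (y (Suc k)) - grad g (y k) + \<tau> *\<^sub>R (dy (Suc k) - dy k)"

lemma drift_eq:
  "drift k = transpose B *v dlam (Suc k)
     - (1 - 1/\<theta>) *\<^sub>R (transpose B *v dlam (Suc k) - transpose B *v dlam k)"
  using multiplier_identity[of k] multiplier_identity[of "Suc k"]
  by (simp add: drift_def dlam_Suc[of k] matrix_vector_mult_diff_distrib algebra_simps)

lemma multiplier_recursion:
  "transpose B *v dlam (Suc k) = (1 - \<theta>) *\<^sub>R (transpose B *v dlam k) + \<theta> *\<^sub>R drift k"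
proof -
  have "\<theta> *\<^sub>R drift k = \<theta> *\<^sub>R (transpose B *v dlam (Suc k))
      - (\<theta> * (1 - 1/\<theta>)) *\<^sub>R (transpose B *v dlam (Suc k) - transpose B *v dlam k)"
    by (simp add: drift_eq scaleR_diff_right)
  also have "\<theta> * (1 - 1/\<theta>) = \<theta> - 1" using \<theta> by (simp add: right_diff_distrib)
  finally show ?thesis by (simp add: algebra_simps)
qed

lemma drift_bound:
  "(norm (drift k))\<^sup>2 \<le> 3 * (L\<^sup>2 + \<tau>\<^sup>2) * ((norm (dy (Suc k)))\<^sup>2 + (norm (dy k))\<^sup>2)"
proof -
  have "drift k = transpose B *v (dlam (Suc k) - (1 - 1/\<theta>) *\<^sub>R (dlam (Suc k) - dlam k))"
    by (simp add: drift_eq matrix_vector_mult_diff_distrib matrix_vector_mult_scaleR)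
  then have "drift k \<in> range (\<lambda>z. transpose B *v z)" by blast
  then have "norm (drift k) \<le> norm (image_proj (transpose B) (grad g (y (Suc k)))
      - image_proj (transpose B) (grad g (y k))) + norm (\<tau> *\<^sub>R (dy (Suc k) - dy k))"
    unfolding drift_def by (rule norm_diff_le_norm_image_proj_diff)
  also have "\<dots> \<le> L * norm (dy (Suc k)) + \<tau> * (norm (dy (Suc k)) + norm (dy k))"
    using grad_lipschitz[of "y (Suc k)" "y k"] \<tau> norm_triangle_ineq4[of "dy (Suc k)" "dy k"]
    by (intro add_mono) (auto simp: dy_Suc[of k] intro: mult_left_mono)
  finally have "(norm (drift k))\<^sup>2
      \<le> (L * norm (dy (Suc k)) + \<tau> * norm (dy (Suc k)) + \<tau> * norm (dy k))\<^sup>2"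
    by (intro power_mono) (auto simp: algebra_simps)
  also have "\<dots> \<le> 3 * ((L * norm (dy (Suc k)))\<^sup>2 + (\<tau> * norm (dy (Suc k)))\<^sup>2 + (\<tau> * norm (dy k))\<^sup>2)"
  proof -
    have "(u + v + w)\<^sup>2 \<le> 3 * (u\<^sup>2 + v\<^sup>2 + w\<^sup>2)" for u v w :: real
    proof -
      have "3 * (u\<^sup>2 + v\<^sup>2 + w\<^sup>2) - (u + v + w)\<^sup>2 = (u - v)\<^sup>2 + (u - w)\<^sup>2 + (v - w)\<^sup>2"
        by (simp add: power2_eq_square algebra_simps)
      moreover have "0 \<le> (u - v)\<^sup>2 + (u - w)\<^sup>2 + (v - w)\<^sup>2" by simp
      ultimately show ?thesis by linarith
    qed
    then show ?thesis .
  qed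
  also have "\<dots> \<le> 3 * (L\<^sup>2 + \<tau>\<^sup>2) * ((norm (dy (Suc k)))\<^sup>2 + (norm (dy k))\<^sup>2)"
  proof -
    have "0 \<le> 3 * (L\<^sup>2 * (norm (dy k))\<^sup>2)" by simp
    then show ?thesis by (simp add: power_mult_distrib algebra_simps)
  qed
  finally show ?thesis .
qed

lemma res_in_range: "res k \<in> range (\<lambda>v. B *v v)"
proof -
  have "b \<in> range (\<lambda>v. B *v v)" "A *v x k \<in> range (\<lambda>v. B *v v)"
    using range_B by auto
  then obtain v w where v: "b = B *v v" and w: "A *v x k = B *v w" by blast
  have "res k = B *v (w + y k - v)"
    unfolding res_def w by (subst v) (simp add: matrix_vector_right_distrib matrix_vector_mult_diff_distrib)
  then show ?thesis by blast
qed

text \<open>Both \<open>b\<close> and the range of \<open>A\<close> lie in the range of \<open>B\<close>, hence so does \<open>dlam (Suc k)\<close>, and it can be measured by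
  \<open>B\<^sup>T dlam (Suc k)\<close>. The contraction factor of the recursion leaves a telescoping difference and the drift.\<close>

lemma multiplier_increment_bound:
  "(norm (dlam (Suc k)))\<^sup>2 / (\<theta> * \<beta>)
    \<le> c1_const B \<theta> \<beta> / 2 * (dual_sq k - dual_sq (Suc k)) + coupling * ((norm (dy (Suc k)))\<^sup>2 + (norm (dy k))\<^sup>2)"
proof -
  let ?\<sigma> = "sigma_pos B" and ?Y = "(norm (dy (Suc k)))\<^sup>2 + (norm (dy k))\<^sup>2"
  note \<sigma> = sigma_pos_pos[OF B_nonzero]
  have "dlam (Suc k) \<in> range (\<lambda>v. B *v v)"
  proof -
    obtain v where "res (Suc k) = B *v v" using res_in_range by blast
    then have "dlam (Suc k) = B *v (- (\<theta> * \<beta>) *\<^sub>R v)"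
      by (simp only: dlam_res matrix_vector_mult_scaleR)
    then show ?thesis by blast
  qed
  then have 1: "?\<sigma> * (norm (dlam (Suc k)))\<^sup>2 \<le> dual_sq (Suc k)"
    by (rule sigma_pos_bound_transpose[OF B_nonzero])
  have 2: "dual_sq (Suc k) \<le> damp * dual_sq k + \<theta>\<^sup>2 / (1 - damp) * (3 * (L\<^sup>2 + \<tau>\<^sup>2) * ?Y)"
  proof -
    have "dual_sq (Suc k) \<le> damp * dual_sq k + \<theta>\<^sup>2 / (1 - damp) * (norm (drift k))\<^sup>2"
      unfolding damp_def by (rule relaxed_recursion_bound[OF \<theta> multiplier_recursion])
    also have "\<dots> \<le> damp * dual_sq k + \<theta>\<^sup>2 / (1 - damp) * (3 * (L\<^sup>2 + \<tau>\<^sup>2) * ?Y)"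
      using damp by (intro add_left_mono mult_left_mono drift_bound) auto
    finally show ?thesis .
  qed
  have "(1 - damp) * (?\<sigma> * (norm (dlam (Suc k)))\<^sup>2) \<le> (1 - damp) * dual_sq (Suc k)"
    using 1 damp by (intro mult_left_mono) auto
  also have "\<dots> \<le> damp * (dual_sq k - dual_sq (Suc k)) + \<theta>\<^sup>2 / (1 - damp) * (3 * (L\<^sup>2 + \<tau>\<^sup>2) * ?Y)"
    using 2 by (simp add: algebra_simps)
  finally have "((1 - damp) * ?\<sigma> * (norm (dlam (Suc k)))\<^sup>2) / ((1 - damp) * ?\<sigma> * (\<theta> * \<beta>))
      \<le> (damp * (dual_sq k - dual_sq (Suc k)) + \<theta>\<^sup>2 / (1 - damp) * (3 * (L\<^sup>2 + \<tau>\<^sup>2) * ?Y)) / ((1 - damp) * ?\<sigma> * (\<theta> * \<beta>))"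
    using damp \<sigma> \<theta> \<beta> by (intro divide_right_mono) (auto simp: mult.assoc)
  also have "\<dots> = damp * (dual_sq k - dual_sq (Suc k)) / ((1 - damp) * ?\<sigma> * (\<theta> * \<beta>))
      + \<theta>\<^sup>2 / (1 - damp) * (3 * (L\<^sup>2 + \<tau>\<^sup>2) * ?Y) / ((1 - damp) * ?\<sigma> * (\<theta> * \<beta>))"
    by (rule add_divide_distrib)
  also have "damp * (dual_sq k - dual_sq (Suc k)) / ((1 - damp) * ?\<sigma> * (\<theta> * \<beta>))
      = c1_const B \<theta> \<beta> / 2 * (dual_sq k - dual_sq (Suc k))"
  proof -
    have "2 * u / (\<beta> * \<theta> * r * ?\<sigma>) / 2 = u / (r * ?\<sigma> * (\<theta> * \<beta>))" for u r :: real
      by (simp add: mult_ac)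
    then have "c1_const B \<theta> \<beta> / 2 = damp / ((1 - damp) * ?\<sigma> * (\<theta> * \<beta>))"
      by (simp only: c1_const_def damp_def)
    then show ?thesis by simp
  qed
  also have "\<theta>\<^sup>2 / (1 - damp) * (3 * (L\<^sup>2 + \<tau>\<^sup>2) * ?Y) / ((1 - damp) * ?\<sigma> * (\<theta> * \<beta>)) = coupling * ?Y"
    using \<theta> by (simp add: coupling_def gamma_const_def damp_def[symmetric] power2_eq_square mult_ac)
  finally show ?thesis
    using damp \<sigma> by simp
qed

text \<open>The \<open>x\<close>-step and the \<open>y\<close>-step decrease the Lagrangian; the multiplier step changes it by
  \<open>- \<langle>dlam, res\<rangle> = \<parallel>dlam\<parallel>\<^sup>2 / (\<theta> \<beta>)\<close>.\<close>

lemma lagr_descent: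
  "lagr (Suc k) \<le> lagr k - 1/2 * (seminorm_of G (x (Suc k) - x k))\<^sup>2
    - curv / 2 * (norm (dy (Suc k)))\<^sup>2 + (norm (dlam (Suc k)))\<^sup>2 / (\<theta> * \<beta>)"
proof -
  define \<rho> where "\<rho> = A *v x (Suc k) + B *v y k - b"
  have x_step: "F (Suc k) + g (y k) - lam k \<bullet> \<rho> + \<beta> / 2 * (norm \<rho>)\<^sup>2
      + 1/2 * (seminorm_of G (x (Suc k) - x k))\<^sup>2 \<le> lagr k"
    using proximal_admm_x_min[OF admm, of k "x k"]
    by (simp add: aug_lagrangian_def F lagr_def res_def \<rho>_def seminorm_of_def)
  have y_step: "g (y (Suc k)) - lam k \<bullet> res (Suc k) + \<beta> / 2 * (norm (res (Suc k)))\<^sup>2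
      + \<tau> / 2 * (norm (dy (Suc k)))\<^sup>2 + curv / 2 * (norm (dy (Suc k)))\<^sup>2
      \<le> g (y k) - lam k \<bullet> \<rho> + \<beta> / 2 * (norm \<rho>)\<^sup>2"
    using y_step_descent[OF weakly_convex less_imp_le[OF \<beta>] proximal_admm_y_min_real[OF admm f_proper],
        of k "y k"]
    by (simp add: curv_def res_def dy_Suc \<rho>_def norm_minus_commute)
  have "lam (Suc k) \<bullet> res (Suc k) = lam k \<bullet> res (Suc k) + dlam (Suc k) \<bullet> res (Suc k)"
    by (simp add: dlam_Suc inner_diff_left)
  moreover have "dlam (Suc k) \<bullet> res (Suc k) = - ((norm (dlam (Suc k)))\<^sup>2 / (\<theta> * \<beta>))"
    using \<theta> \<beta> by (simp add: dlam_res power_mult_distrib power2_norm_eq_inner[symmetric]) (simp add: power2_eq_square)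
  moreover have "0 \<le> \<tau> / 2 * (norm (dy (Suc k)))\<^sup>2" using \<tau> by simp
  ultimately show ?thesis
    using x_step y_step unfolding lagr_def[of "Suc k"] by linarith
qed

text \<open>Half of the curvature gain \<open>curv / 2\<close> of \<open>lagr_descent\<close> is stored in the potential, to pay at the next step for the
  \<open>dy k\<close> part of the drift; the rest pays for the \<open>dy (Suc k)\<close> part. Both leave a surplus \<open>\<delta>1 = curv / 4 - coupling\<close>.\<close>

lemma pot_descent:
  "pot (Suc k) \<le> pot k - 1/2 * (seminorm_of G (x (Suc k) - x k))\<^sup>2
     - delta1 B L m \<theta> \<beta> \<tau> * ((norm (dy (Suc k)))\<^sup>2 + (norm (dy k))\<^sup>2)"
  using lagr_descent[of k] multiplier_increment_bound[of k]
  by (simp add: pot_def delta1_eq algebra_simps)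

lemma pot_antimono: "pot (Suc k) \<le> pot k"
proof -
  have "0 \<le> 1/2 * (seminorm_of G (x (Suc k) - x k))\<^sup>2" by simp
  moreover have "0 \<le> delta1 B L m \<theta> \<beta> \<tau> * ((norm (dy (Suc k)))\<^sup>2 + (norm (dy k))\<^sup>2)"
    using delta1_pos by simp
  ultimately show ?thesis using pot_descent[of k] by linarith
qed

lemma pot_ge_lagr: "lagr k \<le> pot k"
  using c1_nonneg curv_pos by (simp add: pot_def)

text \<open>The multiplier update turns \<open>- \<langle>lam, res\<rangle>\<close> into \<open>\<langle>lam, dlam\<rangle> / (\<theta> \<beta>)\<close>, at least the increment of
  \<open>\<parallel>lam\<parallel>\<^sup>2 / (2 \<theta> \<beta>)\<close>.\<close>

lemma pot_bounded_below: "l \<le> pot k"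
proof (rule antimono_bounded_below_by_telescoping)
  show "pot (Suc k) \<le> pot k" for k by (rule pot_antimono)
  show "0 \<le> (norm (lam k))\<^sup>2 / (2 * (\<theta> * \<beta>))" for k using \<theta> \<beta> by simp
  fix k
  have "lam (Suc k) - dlam (Suc k) = lam k" by (simp add: dlam_Suc)
  then have "(norm (lam k))\<^sup>2 = (norm (lam (Suc k)))\<^sup>2 - 2 * (lam (Suc k) \<bullet> dlam (Suc k)) + (norm (dlam (Suc k)))\<^sup>2"
    using norm_add_power2[of "lam (Suc k)" "- dlam (Suc k)"] by simp
  also have "lam (Suc k) \<bullet> dlam (Suc k) = - (\<theta> * \<beta>) * (lam (Suc k) \<bullet> res (Suc k))"
    by (simp add: dlam_res)
  finally have "(norm (lam (Suc k)))\<^sup>2 - (norm (lam k))\<^sup>2 \<le> 2 * (\<theta> * \<beta>) * - (lam (Suc k) \<bullet> res (Suc k))"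
    by simp
  then have "(norm (lam (Suc k)))\<^sup>2 / (2 * (\<theta> * \<beta>)) - (norm (lam k))\<^sup>2 / (2 * (\<theta> * \<beta>))
      \<le> - (lam (Suc k) \<bullet> res (Suc k))"
    using \<theta> \<beta> by (simp add: diff_divide_distrib[symmetric] pos_divide_le_eq mult.commute)
  also have "\<dots> \<le> lagr (Suc k) - l"
    using below[of "Suc k"] by (simp add: lagr_def res_def)
  also have "\<dots> \<le> pot (Suc k) - l" using pot_ge_lagr[of "Suc k"] by simp
  finally show "(norm (lam (Suc k)))\<^sup>2 / (2 * (\<theta> * \<beta>)) - (norm (lam k))\<^sup>2 / (2 * (\<theta> * \<beta>)) \<le> pot (Suc k) - l" .
qed

text \<open>Let \<open>Y j = \<parallel>dy (Suc j)\<parallel>\<^sup>2 + \<parallel>dy j\<parallel>\<^sup>2\<close>. The potential bounds \<open>\<delta>1\<close> times the sum of \<open>Y\<close> (and the \<open>x\<close> part) by \<open>2 M\<close>. The same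
  sum of \<open>Y\<close> occurs in the bound for the multiplier increments, with coefficient \<open>\<theta> \<beta> coupling = K \<delta>1 / 2\<close>
  where \<open>\<beta> \<theta> + K\<close> is the inverse of \<open>\<delta>2\<close>; so the latter sum to at most
  \<open>\<theta> \<beta> M + K M = M / \<delta>2\<close>.\<close>

lemma sum_progress_le:
  fixes M :: real
  assumes "c1_const B \<theta> \<beta> / 2 * (norm (transpose B *v dlam 0))\<^sup>2
      + (\<beta> * sigma_min B + \<tau> - m) / 4 * (norm (dy 0))\<^sup>2 \<le> M"
    and "lagr 0 - l \<le> M"
  shows "(\<Sum>j<k. 1/2 * (seminorm_of G (x (Suc j) - x j))\<^sup>2
      + delta1 B L m \<theta> \<beta> \<tau> * (norm (y (Suc j) - y j))\<^sup>2
      + delta2 B L m \<theta> \<beta> \<tau> * (norm (lam (Suc j) - lam j))\<^sup>2) \<le> 3 * M"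
proof -
  define X where "X j = 1/2 * (seminorm_of G (x (Suc j) - x j))\<^sup>2" for j
  define Y where "Y j = (norm (dy (Suc j)))\<^sup>2 + (norm (dy j))\<^sup>2" for j
  define Z where "Z j = (norm (dlam (Suc j)))\<^sup>2" for j
  define K where "K = 6 * \<theta> * gamma_const \<theta> * (L\<^sup>2 + \<tau>\<^sup>2) / (sigma_pos B * delta1 B L m \<theta> \<beta> \<tau>)"
  let ?\<delta> = "delta1 B L m \<theta> \<beta> \<tau>" and ?\<delta>2 = "delta2 B L m \<theta> \<beta> \<tau>" and ?c = "c1_const B \<theta> \<beta> / 2"
  \<comment> \<open>\<open>K\<close> is the second summand of the inverse of \<open>\<delta>2\<close>.\<close>
  have K: "\<theta> * \<beta> * coupling = K / 2 * ?\<delta>"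
    using \<beta> delta1_pos by (simp add: K_def coupling_def)
  have K_nonneg: "0 \<le> K"
    using \<theta> delta1_pos sigma_pos_pos[OF B_nonzero] by (simp add: K_def gamma_const_def)
  have \<delta>2: "?\<delta>2 = inverse (\<beta> * \<theta> + K)"
    by (simp add: delta2_def K_def)
  have D0: "?c * dual_sq 0 \<le> M"
  proof -
    have "0 \<le> curv / 4 * (norm (dy 0))\<^sup>2" using curv_pos by simp
    with assms(1) show ?thesis by (simp add: curv_def)
  qed
  have "pot k + (\<Sum>j<k. X j + ?\<delta> * Y j) \<le> pot 0"
  proof (induction k)
    case (Suc k)
    with pot_descent[of k] show ?case by (simp add: X_def Y_def)
  qed simp
  moreover have "pot 0 - l \<le> 2 * M"
    using assms unfolding pot_def curv_def by linarith
  ultimately have XY: "(\<Sum>j<k. X j) + ?\<delta> * (\<Sum>j<k. Y j) \<le> 2 * M"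
    using pot_bounded_below[of k] by (simp add: sum.distrib sum_distrib_left)
  have "(\<Sum>j<k. Z j) + \<theta> * \<beta> * (?c * dual_sq k) \<le> \<theta> * \<beta> * (?c * dual_sq 0) + \<theta> * \<beta> * coupling * (\<Sum>j<k. Y j)"
  proof (induction k)
    case (Suc k)
    have "Z k \<le> (\<theta> * \<beta>) * (?c * (dual_sq k - dual_sq (Suc k)) + coupling * Y k)"
      using multiplier_increment_bound[of k] \<theta> \<beta> by (simp add: Z_def Y_def pos_divide_le_eq mult.commute)
    with Suc show ?case by (simp add: algebra_simps)
  qed simp
  moreover have "0 \<le> \<theta> * \<beta> * (?c * dual_sq k)" using \<theta> \<beta> c1_nonneg by simp
  moreover have "\<theta> * \<beta> * (?c * dual_sq 0) \<le> \<theta> * \<beta> * M" using \<theta> \<beta> D0 by (intro mult_left_mono) auto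
  moreover have "\<theta> * \<beta> * coupling * (\<Sum>j<k. Y j) \<le> K * M"
  proof -
    have "0 \<le> (\<Sum>j<k. X j)" by (intro sum_nonneg) (simp add: X_def)
    with XY have "?\<delta> * (\<Sum>j<k. Y j) \<le> 2 * M" by linarith
    then have "K / 2 * (?\<delta> * (\<Sum>j<k. Y j)) \<le> K / 2 * (2 * M)"
      using K_nonneg by (intro mult_left_mono) auto
    then show ?thesis unfolding K by (simp add: mult.assoc)
  qed
  ultimately have "(\<Sum>j<k. Z j) \<le> (\<beta> * \<theta> + K) * M"
    by (simp add: algebra_simps)
  moreover have pos: "0 < \<beta> * \<theta> + K"
    using \<theta> \<beta> K_nonneg by (simp add: add_pos_nonneg)
  ultimately have "?\<delta>2 * (\<Sum>j<k. Z j) \<le> ?\<delta>2 * ((\<beta> * \<theta> + K) * M)"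
    unfolding \<delta>2 by (intro mult_left_mono) auto
  moreover have "?\<delta>2 * ((\<beta> * \<theta> + K) * M) = M"
    using pos unfolding \<delta>2 mult.assoc[symmetric] by simp
  ultimately have Z: "?\<delta>2 * (\<Sum>j<k. Z j) \<le> M" by linarith
  have "(\<Sum>j<k. 1/2 * (seminorm_of G (x (Suc j) - x j))\<^sup>2
      + delta1 B L m \<theta> \<beta> \<tau> * (norm (y (Suc j) - y j))\<^sup>2
      + delta2 B L m \<theta> \<beta> \<tau> * (norm (lam (Suc j) - lam j))\<^sup>2)
      \<le> (\<Sum>j<k. X j + ?\<delta> * Y j + ?\<delta>2 * Z j)"
    using delta1_pos
    by (intro sum_mono) (simp add: X_def Y_def Z_def dy_Suc dlam_Suc mult_left_mono)
  also have "\<dots> = (\<Sum>j<k. X j) + ?\<delta> * (\<Sum>j<k. Y j) + ?\<delta>2 * (\<Sum>j<k. Z j)"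
    by (simp add: sum.distrib sum_distrib_left)
  finally show ?thesis using XY Z by linarith
qed

end

section \<open>Iteration complexity\<close>

lemma exists_le_average:
  fixes p :: "nat \<Rightarrow> real"
  assumes "0 < k" "(\<Sum>j<k. p j) \<le> S"
  obtains j where "j < k" "p j \<le> S / real k"
proof -
  have "\<exists>j<k. p j \<le> S / real k"
  proof (rule ccontr)
    assume "\<not> ?thesis"
    then have "(\<Sum>j<k. S / real k) < (\<Sum>j<k. p j)"
      using assms(1) by (intro sum_strict_mono) (auto simp: not_le)
    with assms show False by simp
  qed
  then show thesis using that by blast
qed

lemma matrix_norm_gram_pos:
  fixes B :: "real^'p^'l"
  assumes "B \<noteq> 0"
  shows "0 < matrix_norm (transpose B ** B)"
proof -
  obtain v where v: "B *v v \<noteq> 0" using assms by (auto simp: matrix_eq)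
  have "(transpose B *v (B *v v)) \<bullet> v = (B *v v) \<bullet> (B *v v)" by (rule inner_transpose_mult)
  with v have "(transpose B ** B) *v v \<noteq> 0" by (auto simp: matrix_vector_mul_assoc[symmetric])
  then have "0 < matrix_norm (transpose B ** B) * norm v"
    using matrix_norm_mult_le[of "transpose B ** B" v] by (meson less_le_trans zero_less_norm_iff)
  then show ?thesis by (simp add: zero_less_mult_iff)
qed

lemma le_scaled_sqrtI:
  fixes c d t s :: real
  assumes "c * t\<^sup>2 \<le> s" "0 < c"
  shows "t \<le> sqrt (s / c)"
  using assms by (intro real_le_rsqrt) (simp add: pos_le_divide_eq mult.commute)

lemma esqrt_simps: "esqrt \<infinity> = \<infinity>" "esqrt (ereal z) = ereal (sqrt z)"
  by (simp_all add: esqrt_def)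

theorem theorem2p2:
  fixes f :: "real^'n \<Rightarrow> ereal" and g :: "real^'p \<Rightarrow> real"
    and A :: "real^'n^'l" and B :: "real^'p^'l" and b :: "real^'l"
    and G :: "real^'n^'n"
    and L m \<beta>bar \<theta> \<beta> \<tau> :: real
    and x :: "nat \<Rightarrow> real^'n" and y :: "nat \<Rightarrow> real^'p" and lam lamhat :: "nat \<Rightarrow> real^'l"
    and Lbar \<eta>0 \<Delta>0 :: ereal and \<delta>1 \<delta>2 :: real
  assumes A0: "proper f" "lsc f"
    and A1: "B \<noteq> 0" "insert b (range (\<lambda>u. A *v u)) \<subseteq> range (\<lambda>v. B *v v)"
    and A2: "\<forall>v. g differentiable (at v)" "L > 0"
      "\<forall>v v'. norm (image_proj (transpose B) (grad g v') - image_proj (transpose B) (grad g v))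
                \<le> L * norm (v' - v)"
    and A3: "m \<ge> 0" "convex_on UNIV (\<lambda>v. g v + m / 2 * (norm v)\<^sup>2)"
    and Lbar: "Lbar = penalty_inf f g A B b \<beta>bar"
    and A4: "\<beta>bar \<ge> 0" "Lbar > -\<infinity>"
    and G: "pos_semidef G"
    and \<theta>: "0 < \<theta>" "\<theta> < 2"
    and \<beta>: "\<beta> > 0" "\<beta> \<ge> \<beta>bar"
    and \<tau>: "\<tau> \<ge> 0"
    and \<delta>1: "\<delta>1 = delta1 B L m \<theta> \<beta> \<tau>" "\<delta>1 > 0"
    and \<delta>2: "\<delta>2 = delta2 B L m \<theta> \<beta> \<tau>"
    and admm: "proximal_admm f g A B b G \<theta> \<beta> \<tau> x y lam"
    and \<eta>0: "\<eta>0 = eta0 g B m \<theta> \<beta> \<tau> (y 0) (lam 0)" "\<bar>\<eta>0\<bar> \<noteq> \<infinity>"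
    and \<Delta>0: "\<Delta>0 = aug_lagrangian f g A B b \<beta> (x 0) (y 0) (lam 0) - Lbar"
    and lamhat: "\<forall>k\<ge>1. lamhat k = lam (k-1) - \<beta> *\<^sub>R (A *v x k + B *v y (k-1) - b)"
  shows "\<forall>k\<ge>1.
      - (G *v (x k - x (k-1))) \<in> (\<lambda>u. u - transpose A *v lamhat k) ` lim_subdiff f (x k) \<and>
      (\<exists>j. 1 \<le> j \<and> j \<le> k \<and>
         ereal (seminorm_of G (x j - x (j-1))) \<le> esqrt (6 * max \<eta>0 \<Delta>0 / ereal (real k)) \<and>
         ereal (norm (grad g (y j) - transpose B *v lamhat j))
           \<le> ereal (\<beta> * matrix_norm (transpose B ** B) + \<tau>)
               * esqrt (3 * max \<eta>0 \<Delta>0 / ereal (\<delta>1 * real k)) \<and>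
         ereal (norm (A *v x j + B *v y j - b))
           \<le> ereal (1 / (\<beta> * \<theta>)) * esqrt (3 * max \<eta>0 \<Delta>0 / ereal (\<delta>2 * real k)))"
proof (intro allI impI conjI)
  fix k :: nat assume k: "1 \<le> k"
  then obtain i where i: "k = Suc i" by (cases k) auto
  have "transpose A *v lamhat k - G *v (x k - x (k - 1)) \<in> frechet_subdiff f (x k)"
    using x_step_subdiff[OF A0(1) G less_imp_le[OF \<beta>(1)] proximal_admm_x_min[OF admm], of i] lamhat i
    by simp
  then have "transpose A *v lamhat k - G *v (x k - x (k - 1)) \<in> lim_subdiff f (x k)"
    using frechet_subdiff_subset_lim_subdiff by blast
  then show "- (G *v (x k - x (k - 1))) \<in> (\<lambda>u. u - transpose A *v lamhat k) ` lim_subdiff f (x k)"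
    by (rule rev_image_eqI) simp
next
  fix k :: nat assume k: "1 \<le> k"
  let ?R = "\<lambda>j. 1 \<le> j \<and> j \<le> k \<and>
         ereal (seminorm_of G (x j - x (j-1))) \<le> esqrt (6 * max \<eta>0 \<Delta>0 / ereal (real k)) \<and>
         ereal (norm (grad g (y j) - transpose B *v lamhat j))
           \<le> ereal (\<beta> * matrix_norm (transpose B ** B) + \<tau>)
               * esqrt (3 * max \<eta>0 \<Delta>0 / ereal (\<delta>1 * real k)) \<and>
         ereal (norm (A *v x j + B *v y j - b))
           \<le> ereal (1 / (\<beta> * \<theta>)) * esqrt (3 * max \<eta>0 \<Delta>0 / ereal (\<delta>2 * real k))"
  let ?N = "\<beta> * matrix_norm (transpose B ** B) + \<tau>"
  have N: "0 < ?N" using matrix_norm_gram_pos[OF A1(1)] \<beta>(1) \<tau> by (simp add: add_pos_nonneg)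
  have \<delta>2_pos: "0 < \<delta>2"
  proof -
    have "0 \<le> 6 * \<theta> * gamma_const \<theta> * (L\<^sup>2 + \<tau>\<^sup>2) / (sigma_pos B * \<delta>1)"
      using \<theta> \<delta>1(2) sigma_pos_pos[OF A1(1)] by (simp add: gamma_const_def)
    then show ?thesis using \<theta> \<beta>(1) by (simp add: \<delta>2 delta2_def \<delta>1(1)[symmetric] add_pos_nonneg)
  qed
  show "\<exists>j. ?R j"
  proof (cases "f (x 0) = \<infinity>")
    case True
    \<comment> \<open>All right-hand sides are infinite; their scalar factors are positive because \<open>B \<noteq> 0\<close>.\<close>
    then have "max \<eta>0 \<Delta>0 = \<infinity>"
      using A4(2) by (simp add: \<Delta>0 aug_lagrangian_def max_def)
    then have "?R 1"
      using k N \<delta>1(2) \<delta>2_pos \<theta> \<beta>(1) by (simp add: esqrt_simps)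
    then show ?thesis by blast
  next
    case False
    have fin: "\<exists>r. f (x n) = ereal r" for n
    proof (cases n)
      case 0
      with False A0(1) show ?thesis by (cases "f (x 0)") (auto simp: proper_def)
    next
      case (Suc n')
      then show ?thesis using proximal_admm_f_finite[OF admm A0(1)] by metis
    qed
    then obtain F where F: "\<And>n. f (x n) = ereal (F n)" by metis
    have Lbar_le: "Lbar \<le> ereal (F n + g (y n) + \<beta>bar / 2 * (norm (A *v x n + B *v y n - b))\<^sup>2)" for n
    proof -
      have "Lbar \<le> f (x n) + ereal (g (y n) + \<beta>bar / 2 * (norm (A *v x n + B *v y n - b))\<^sup>2)"
        unfolding Lbar penalty_inf_def by (rule INF_lower2[of "(x n, y n)"]) auto
      then show ?thesis by (simp add: F add.assoc)
    qed
    obtain l where l: "Lbar = ereal l"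
      using A4(2) Lbar_le[of 0] by (cases Lbar) auto
    have below: "l \<le> F n + g (y n) + \<beta> / 2 * (norm (A *v x n + B *v y n - b))\<^sup>2" for n
    proof -
      have "\<beta>bar / 2 * (norm (A *v x n + B *v y n - b))\<^sup>2 \<le> \<beta> / 2 * (norm (A *v x n + B *v y n - b))\<^sup>2"
        using \<beta>(2) by (intro mult_right_mono) auto
      with Lbar_le[of n] l show ?thesis by simp
    qed
    define \<Delta> where "\<Delta> = F 0 + g (y 0) - lam 0 \<bullet> (A *v x 0 + B *v y 0 - b)
      + \<beta> / 2 * (norm (A *v x 0 + B *v y 0 - b))\<^sup>2 - l"
    have \<Delta>: "\<Delta>0 = ereal \<Delta>"
      by (simp add: \<Delta>0 aug_lagrangian_def F l \<Delta>_def)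
    obtain e where e: "\<eta>0 = ereal e" using \<eta>0(2) by auto
    define p where "p j = 1/2 * (seminorm_of G (x (Suc j) - x j))\<^sup>2
      + \<delta>1 * (norm (y (Suc j) - y j))\<^sup>2 + \<delta>2 * (norm (lam (Suc j) - lam j))\<^sup>2" for j
    have feasible: "(\<Sum>j<k. p j) \<le> 3 * max (c1_const B \<theta> \<beta> / 2 * (norm (transpose B *v dlam0))\<^sup>2
               + (\<beta> * sigma_min B + \<tau> - m) / 4 * (norm dy0)\<^sup>2) \<Delta>"
      if init: "\<tau> *\<^sub>R dy0 + (1 - 1/\<theta>) *\<^sub>R (transpose B *v dlam0) = transpose B *v lam 0 - grad g (y 0)"
      for dy0 dlam0
    proof -
      interpret finite_proximal_admm_run f g A B b G L m \<theta> \<beta> \<tau> x y lam F l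
        "\<lambda>n. case n of 0 \<Rightarrow> dy0 | Suc i \<Rightarrow> y (Suc i) - y i"
        "\<lambda>n. case n of 0 \<Rightarrow> dlam0 | Suc i \<Rightarrow> lam (Suc i) - lam i"
        using A0(1) F A1 A2(1,3) A3(2) \<theta> \<beta>(1) \<tau> \<delta>1 admm below init by unfold_locales auto
      show ?thesis
        unfolding p_def \<delta>1(1) \<delta>2
        by (rule sum_progress_le) (simp_all add: lagr_def res_def \<Delta>_def)
    qed
    have sum_le: "(\<Sum>j<k. p j) \<le> 3 * max e \<Delta>"
    proof (cases "(\<Sum>j<k. p j) \<le> 3 * \<Delta>")
      case False
      \<comment> \<open>The sum is then bounded by the value of every feasible pair, hence by the infimum.\<close>
      have "ereal ((\<Sum>j<k. p j) / 3) \<le> \<eta>0"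
        unfolding \<eta>0(1) eta0_def
      proof (rule INF_greatest, clarify)
        fix dy0 dlam0
        assume "\<tau> *\<^sub>R dy0 + (1 - 1/\<theta>) *\<^sub>R (transpose B *v dlam0) = transpose B *v lam 0 - grad g (y 0)"
        from feasible[OF this] False
        show "ereal ((\<Sum>j<k. p j) / 3) \<le> ereal (c1_const B \<theta> \<beta> / 2 * (norm (transpose B *v dlam0))\<^sup>2
               + (\<beta> * sigma_min B + \<tau> - m) / 4 * (norm dy0)\<^sup>2)"
          unfolding max_def ereal_less_eq by (auto split: if_splits)
      qed
      then show ?thesis by (simp add: e max_def)
    qed (simp add: max_def)
    define M where "M = max e \<Delta>"
    have M: "max \<eta>0 \<Delta>0 = ereal M" by (simp add: e \<Delta> M_def max_def)
    obtain j where j: "j < k" "p j \<le> 3 * M / real k"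
      using exists_le_average[of k p "3 * M"] k sum_le by (auto simp: M_def)
    let ?s = "3 * M / real k"
    have nonneg: "0 \<le> \<delta>1 * (norm (y (Suc j) - y j))\<^sup>2" "0 \<le> \<delta>2 * (norm (lam (Suc j) - lam j))\<^sup>2"
      "0 \<le> 1/2 * (seminorm_of G (x (Suc j) - x j))\<^sup>2"
      using \<delta>1(2) \<delta>2_pos by auto
    have X: "1/2 * (seminorm_of G (x (Suc j) - x j))\<^sup>2 \<le> ?s"
      and Y: "\<delta>1 * (norm (y (Suc j) - y j))\<^sup>2 \<le> ?s"
      and Z: "\<delta>2 * (norm (lam (Suc j) - lam j))\<^sup>2 \<le> ?s"
      using j(2) nonneg unfolding p_def by linarith+
    have 1: "seminorm_of G (x (Suc j) - x j) \<le> sqrt (6 * M / real k)"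
      using le_scaled_sqrtI[OF X] by simp
    have 2: "norm (grad g (y (Suc j)) - transpose B *v lamhat (Suc j)) \<le> ?N * sqrt (3 * M / (\<delta>1 * real k))"
    proof -
      have "norm (grad g (y (Suc j)) - transpose B *v lamhat (Suc j)) \<le> ?N * norm (y (Suc j) - y j)"
        using proximal_admm_dual_residual[OF admm A0(1), of j] A2(1) \<beta>(1) \<tau> lamhat by simp
      also have "\<dots> \<le> ?N * sqrt (3 * M / (\<delta>1 * real k))"
        using le_scaled_sqrtI[OF Y \<delta>1(2)] N by (intro mult_left_mono) (auto simp: mult.commute)
      finally show ?thesis .
    qed
    have 3: "norm (A *v x (Suc j) + B *v y (Suc j) - b) \<le> 1 / (\<beta> * \<theta>) * sqrt (3 * M / (\<delta>2 * real k))"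
    proof -
      have "\<theta> * \<beta> * norm (A *v x (Suc j) + B *v y (Suc j) - b) = norm (lam (Suc j) - lam j)"
        using \<theta> \<beta>(1) unfolding proximal_admm_multiplier[OF admm] by simp
      also have "\<dots> \<le> sqrt (3 * M / (\<delta>2 * real k))"
        using le_scaled_sqrtI[OF Z \<delta>2_pos] by (simp add: mult.commute)
      finally show ?thesis using \<theta> \<beta>(1) by (simp add: field_simps)
    qed
    have "?R (Suc j)"
      unfolding M using j(1) k 1 2 3 \<delta>1(2) \<delta>2_pos by (simp add: esqrt_simps)
    then show ?thesis by blast
  qed
qed

end
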